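(* Let $\delta\in(0,1/3)$, $n\ge1$, $d\ge1$, $\beta\ge2$ and $m\in\{1,\dots,n\}$ be such that $m\ge4\log(4(2n+1)^{2d}/\delta)$. Suppose that $(X,Y),(X_1,Y_1),\dots,(X_n,Y_n)$ are i.i.d., that $X$ has a density $f_X$ on $S_X=[0,1]^d$ with $f_X(x)\ge b>0$ for all $x\in S_X$, that $\varepsilon=Y-g(X)$ is sub-Gaussian conditionally on $X$ with parameter $\sigma^2$, and that $g$ is $L$-Lipschitz on $S_X$. Let $\mathcal V$ be the local regression map obtained from a CART-like tree with input parameters $\beta$, $m$ and cost function $M_n$. Then, with probability at least $1-3\delta$, for all $x\in S_X$, $$|\hat g_{\mathcal V}(x)-g(x)|\le\sqrt{\frac{2\sigma^2\log((n+1)^{2d}/\delta)}m}+L(\mathcal V(x))\,\beta\sqrt d\left(\frac{5m}{nb}\right)^{1/d}.$$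
   Context: Setting: $(X,Y)$ is a random vector in $\mathbb R^d\times\mathbb R$, $X\in S_X=[0,1]^d$, $g(x)=\mathbb E[Y\mid X=x]$, $\varepsilon=Y-g(X)$. Sub-Gaussian conditionally on $X$ with parameter $\sigma^2$: $\mathbb E[\varepsilon\mid X]=0$ and $\mathbb E[\exp(t\varepsilon)\mid X]\le\exp(t^2\sigma^2/2)$ a.s. for all $t\in\mathbb R$. $nP_n^X(A)=\sum_{i=1}^n\mathbf 1_A(X_i)$. Lipschitz is with respect to $\|\cdot\|_2$; for $V\subset S_X$, $L(V)$ is the smallest constant with $|g(y)-g(z)|\le L(V)\|y-z\|_2$ for all $y,z\in V$. CART-like tree. For a hyper-rectangle $V\subset[0,1]^d$ (cell), $h_k(V)$ is its side length along coordinate $k$, $h_-(V)=\min_kh_k(V)$, $h_+(V)=\max_kh_k(V)$. A split is a pair $(p,u)\in S=\{1,\dots,d\}\times(0,1)$: it cuts $V$ orthogonally to coordinate $p$ into two children $V(l),V(r)$ partitioning $V$, with $h_k(V(l))=h_k(V(r))=h_k(V)$ for $k\ne p$, $h_p(V(l))=u\,h_p(V)$ and $h_p(V(r))=(1-u)h_p(V)$. Define $$S_\beta(V)=\{(p,u)\in S:h_+(V(s))\le\beta h_-(V(s)),\ s\in\{l,r\}\},$$ $$S_m(V)=\{(p,u)\in S:nP_n^X(V(s))\ge m,\ s\in\{l,r\}\}.$$ The cost function $M_n:S\times\mathcal R([0,1]^d)\to\mathbb R$, with $\mathcal R([0,1]^d)$ the set of hyper-rectangles in $[0,1]^d$, is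 arbitrary and may depend on the whole sample $(X_i,Y_i)_{i\le n}$; the only requirement is that, whenever $S_m(V)\ne\emptyset$, a minimizer of $(p,u)\mapsto M_n((p,u),V)$ on $S_\beta(V)\cap S_m(V)$ exists. Starting from the partition $\{[0,1]^d\}$, at each step every current cell $V$ with $S_m(V)\ne\emptyset$ is replaced by its two children for a split minimizing $M_n(\cdot,V)$ over $S_\beta(V)\cap S_m(V)$, and every cell with $S_m(V)=\emptyset$ is kept unchanged; the procedure stops when no cell changes. $\mathcal V(x)$ is the element of the final partition containing $x$, and $$\hat g_{\mathcal V}(x)=\frac{\sum_{i=1}^nY_i\mathbf 1_{\mathcal V(x)}(X_i)}{\sum_{i=1}^n\mathbf 1_{\mathcal V(x)}(X_i)},\qquad0/0=0.$$ *)

theory Defs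
  imports "HOL-Probability.Probability"
begin

text \<open>
  Regression function: \<open>g x = E[Y | X = x]\<close>, i.e. \<open>g \<circ> X\<close> is a version of the conditional
  expectation of \<open>Y\<close> given the \<open>\<sigma>\<close>-algebra generated by \<open>X\<close>.
\<close>

definition sigma_gen :: "'w measure \<Rightarrow> ('w \<Rightarrow> 'b::topological_space) \<Rightarrow> 'w measure" where
  "sigma_gen M X = vimage_algebra (space M) X borel"

definition regression_function ::
  "'w measure \<Rightarrow> ('w \<Rightarrow> 'b::topological_space) \<Rightarrow> ('w \<Rightarrow> real) \<Rightarrow> ('b \<Rightarrow> real) \<Rightarrow> bool" where
  "regression_function M X Y g \<longleftrightarrow>
     integrable M Y \<and> g \<in> borel_measurable borel \<and>
     (AE w in M. real_cond_exp M (sigma_gen M X) Y w = g (X w))"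

text \<open>
  The exponential moments are stated with the nonnegative conditional expectation, because
  \<open>real_cond_exp\<close> returns a junk value at points where the conditional expectation is infinite.
\<close>

definition cond_sub_gaussian ::
  "'w measure \<Rightarrow> ('w \<Rightarrow> 'b::topological_space) \<Rightarrow> ('w \<Rightarrow> real) \<Rightarrow> real \<Rightarrow> bool" where
  "cond_sub_gaussian M X e v \<longleftrightarrow>
     integrable M e \<and>
     (AE w in M. real_cond_exp M (sigma_gen M X) e w = 0) \<and>
     (\<forall>t. AE w in M. nn_cond_exp M (sigma_gen M X) (\<lambda>w. ennreal (exp (t * e w))) w
                      \<le> ennreal (exp (t\<^sup>2 * v / 2)))"

text \<open>The infimum is attained whenever \<open>g\<close> is Lipschitz on \<open>V\<close>.\<close>

definition lip_const :: "('b::metric_space \<Rightarrow> real) \<Rightarrow> 'b set \<Rightarrow> real" where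
  "lip_const g V = Inf {C. C-lipschitz_on V g}"

abbreviation unit_cube :: "(real ^ 'd) set" where
  "unit_cube \<equiv> cbox 0 1"

text \<open>
  Cells are sets of points. All cells produced below are bounded products of intervals, each of
  which may be open, closed or half-open.
\<close>

definition side :: "(real ^ 'd) set \<Rightarrow> 'd \<Rightarrow> real" where
  "side V k = (SUP x\<in>V. x $ k) - (INF x\<in>V. x $ k)"

definition h_max :: "(real ^ 'd) set \<Rightarrow> real" where
  "h_max V = Max (range (side V))"

definition h_min :: "(real ^ 'd) set \<Rightarrow> real" where
  "h_min V = Min (range (side V))"

definition splits :: "('d \<times> real) set" where
  "splits = UNIV \<times> {0<..<1}"

text \<open>
  The cutting hyperplane has to be given to one of the two children. The arbitrary
  predicate \<open>cl\<close> makes this choice: it holds if the hyperplane belongs to the left child.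
\<close>

type_synonym 'd tie_rule = "(real ^ 'd) set \<Rightarrow> 'd \<times> real \<Rightarrow> bool"

definition cut_point :: "(real ^ 'd) set \<Rightarrow> 'd \<times> real \<Rightarrow> real" where
  "cut_point V s = (INF x\<in>V. x $ fst s) + snd s * side V (fst s)"

definition left_child :: "'d tie_rule \<Rightarrow> (real ^ 'd) set \<Rightarrow> 'd \<times> real \<Rightarrow> (real ^ 'd) set" where
  "left_child cl V s =
     {x \<in> V. x $ fst s < cut_point V s \<or> cl V s \<and> x $ fst s = cut_point V s}"

definition right_child :: "'d tie_rule \<Rightarrow> (real ^ 'd) set \<Rightarrow> 'd \<times> real \<Rightarrow> (real ^ 'd) set" where
  "right_child cl V s = V - left_child cl V s"

definition children :: "'d tie_rule \<Rightarrow> (real ^ 'd) set \<Rightarrow> 'd \<times> real \<Rightarrow> (real ^ 'd) set set" where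
  "children cl V s = {left_child cl V s, right_child cl V s}"

definition num_points :: "nat \<Rightarrow> (nat \<Rightarrow> 'b) \<Rightarrow> 'b set \<Rightarrow> nat" where
  "num_points n x V = (\<Sum>i=1..n. indicator V (x i))"

definition S_beta :: "'d tie_rule \<Rightarrow> real \<Rightarrow> (real ^ 'd) set \<Rightarrow> ('d \<times> real) set" where
  "S_beta cl \<beta> V = {s \<in> splits. \<forall>W \<in> children cl V s. h_max W \<le> \<beta> * h_min W}"

definition S_m ::
  "'d tie_rule \<Rightarrow> nat \<Rightarrow> (nat \<Rightarrow> real ^ 'd) \<Rightarrow> nat \<Rightarrow> (real ^ 'd) set \<Rightarrow> ('d \<times> real) set" where
  "S_m cl n x m V = {s \<in> splits. \<forall>W \<in> children cl V s. num_points n x W \<ge> m}"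

text \<open>
  One simultaneous refinement of all cells of the partition \<open>P\<close>; \<open>x\<close> is the sample of
  covariates, \<open>c\<close> the cost and \<open>sel\<close> the selected splits. If some cell \<open>V\<close> with \<open>S_m V \<noteq> {}\<close>
  has no minimizing split, \<open>P\<close> has no successor.
\<close>

definition cart_step ::
  "'d tie_rule \<Rightarrow> nat \<Rightarrow> (nat \<Rightarrow> real ^ 'd) \<Rightarrow> real \<Rightarrow> nat \<Rightarrow>
   ('d \<times> real \<Rightarrow> (real ^ 'd) set \<Rightarrow> real) \<Rightarrow>
   (real ^ 'd) set set \<Rightarrow> (real ^ 'd) set set \<Rightarrow> bool" where
  "cart_step cl n x \<beta> m c P P' \<longleftrightarrow>
     (\<exists>sel.
        (\<forall>V\<in>P. S_m cl n x m V \<noteq> {} \<longrightarrow>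
           is_arg_min (\<lambda>s. c s V) (\<lambda>s. s \<in> S_beta cl \<beta> V \<inter> S_m cl n x m V) (sel V)) \<and>
        P' = (\<Union>V\<in>P. if S_m cl n x m V = {} then {V} else children cl V (sel V)))"

text \<open>\<open>P\<close> is a final partition of the procedure, for some choice among tied minimizers.\<close>

definition cart_partition ::
  "'d tie_rule \<Rightarrow> nat \<Rightarrow> (nat \<Rightarrow> real ^ 'd) \<Rightarrow> real \<Rightarrow> nat \<Rightarrow>
   ('d \<times> real \<Rightarrow> (real ^ 'd) set \<Rightarrow> real) \<Rightarrow> (real ^ 'd) set set \<Rightarrow> bool" where
  "cart_partition cl n x \<beta> m c P \<longleftrightarrow>
     (cart_step cl n x \<beta> m c)\<^sup>*\<^sup>* {unit_cube} P \<and> (\<forall>V\<in>P. S_m cl n x m V = {})"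

definition cell_of :: "'b set set \<Rightarrow> 'b \<Rightarrow> 'b set" where
  "cell_of P z = (THE V. V \<in> P \<and> z \<in> V)"

text \<open>The convention \<open>0 / 0 = 0\<close> is the one of HOL's division.\<close>

definition local_estimator ::
  "nat \<Rightarrow> (nat \<Rightarrow> 'b) \<Rightarrow> (nat \<Rightarrow> real) \<Rightarrow> 'b set set \<Rightarrow> 'b \<Rightarrow> real" where
  "local_estimator n x y P z =
     (\<Sum>i=1..n. y i * indicator (cell_of P z) (x i)) /
     (\<Sum>i=1..n. indicator (cell_of P z) (x i))"

end

theory Submission
  imports Defs
begin

text \<open>
  Every final cell contains between \<open>m\<close> and \<open>2m - 1\<close> sample points: if it had \<open>2m\<close> of them, then,
  since almost surely no two points share a coordinate, a cut between the \<open>m\<close>-th and the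
  \<open>(m + 1)\<close>-st point would be admissible.

  Bias. If the smallest side of a cell exceeds \<open>(5m/(nb))\<^bsup>1/d\<^esup>\<close>, then the cell contains a box with
  corners in the grid of mesh \<open>1/(2n)\<close> of volume at least \<open>4m/(nb)\<close>, because trimming to the grid
  costs at most \<open>d/n\<close> in volume. Such a box has probability at least \<open>4m/n\<close>, so it contains at most
  \<open>2m\<close> points only with probability \<open>exp(-m/4)\<close>. There are \<open>(2n + 1)\<^bsup>2d\<^esup>\<close> grid boxes, and a union bound
  replaces the Vapnik-Chervonenkis inequality.

  Variance. The sample points in a cell are those in the bounding box that they span, so at most
  \<open>n\<^bsup>2d\<^esup>\<close> index sets occur, each a function of the covariates. For such a set \<open>S\<close> the exponential moment
  of \<open>\<Sum>i\<in>S. (t * \<epsilon> i - t\<^sup>2 * \<sigma>\<^sup>2 / 2)\<close> is at most \<open>1\<close>. Since the subtracted term depends on the size of \<open>S\<close>,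
  the choice \<open>t = s / \<sigma>\<^sup>2\<close> works simultaneously for all sizes at least \<open>m\<close>.
\<close>

subsection \<open>Cells of the tree\<close>

text \<open>A cutting face goes to only one of the two children, so cells are in general neither
  open nor closed. Each \<open>J k\<close> is pinned only between the open and the closed interval,
  which covers every choice of faces. The strict inequality of the corners makes \<open>a\<close>
  and \<open>b\<close> recoverable from \<open>V\<close>.\<close>

definition cell :: "real ^ 'd \<Rightarrow> real ^ 'd \<Rightarrow> (real ^ 'd) set \<Rightarrow> bool" where
  "cell a b V \<longleftrightarrow> (\<forall>k. a $ k < b $ k) \<and>
     (\<exists>J. V = {x. \<forall>k. x $ k \<in> J k} \<and> (\<forall>k. {a $ k<..<b $ k} \<subseteq> J k \<and> J k \<subseteq> {a $ k..b $ k}))"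

lemma cellE:
  assumes "cell a b V"
  obtains J where "\<And>k. a $ k < b $ k" "V = {x. \<forall>k. x $ k \<in> J k}"
    "\<And>k. {a $ k<..<b $ k} \<subseteq> J k" "\<And>k. J k \<subseteq> {a $ k..b $ k}"
  using assms unfolding cell_def by blast

lemma cellI:
  assumes "\<And>k. a $ k < b $ k" "V = {x. \<forall>k. x $ k \<in> J k}"
    "\<And>k. {a $ k<..<b $ k} \<subseteq> J k" "\<And>k. J k \<subseteq> {a $ k..b $ k}"
  shows "cell a b V"
  unfolding cell_def using assms by blast

lemma cell_unit_cube: "cell 0 1 (unit_cube :: (real ^ 'd) set)"
  unfolding cell_def
  by (auto simp: mem_box_cart intro!: exI[of _ "\<lambda>_. {0..1}"])

lemma box_subset_cell: "cell a b V \<Longrightarrow> box a b \<subseteq> V"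
  by (erule cellE) (fastforce simp: mem_box_cart subset_iff)

lemma cell_nonempty: "cell a b V \<Longrightarrow> V \<noteq> {}"
  using box_subset_cell[of a b V] interval_ne_empty_cart(2)[of a b] by (auto simp: cell_def)

lemma cell_subset_cbox: "cell a b V \<Longrightarrow> V \<subseteq> cbox a b"
  by (erule cellE) (force simp: mem_box_cart subset_iff)

text \<open>If \<open>x $ k\<close> lies strictly between the corners, it is in \<open>J k\<close>
  by the inner inclusion; otherwise it is an end point and coincides with the coordinate of one of
  the two witnesses. The witnesses may change with \<open>k\<close>, as extreme sample points
  do.\<close>

lemma cell_order_convex:
  assumes "cell a b V" "\<And>k. p k \<in> V" "\<And>k. q k \<in> V" "\<And>k. p k $ k \<le> x $ k" "\<And>k. x $ k \<le> q k $ k"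
  shows "x \<in> V"
proof -
  obtain J where J: "\<And>k. a $ k < b $ k" "V = {x. \<forall>k. x $ k \<in> J k}"
    "\<And>k. {a $ k<..<b $ k} \<subseteq> J k" "\<And>k. J k \<subseteq> {a $ k..b $ k}"
    using assms(1) by (elim cellE) (rule that)
  have "x $ k \<in> J k" for k
  proof -
    have pq: "p k $ k \<in> J k" "q k $ k \<in> J k"
      using assms(2,3) J(2) by auto
    then have "x $ k \<in> {a $ k<..<b $ k} \<or> x $ k = p k $ k \<or> x $ k = q k $ k"
      using assms(4,5)[of k] J(4)[of k] by force
    then show ?thesis
      using pq J(3)[of k] by auto
  qed
  then show ?thesis using J(2) by simp
qed

text \<open>For surjectivity, prescribe coordinate \<open>k\<close> and put midpoints in all
  others.\<close>

lemma cell_coordinate_image: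
  fixes V :: "(real ^ 'd) set"
  assumes J: "\<And>k. a $ k < b $ k" "V = {x. \<forall>k. x $ k \<in> J k}" "\<And>k. {a $ k<..<b $ k} \<subseteq> J k"
  shows "(\<lambda>x. x $ k) ` V = J k"
proof
  show "(\<lambda>x. x $ k) ` V \<subseteq> J k" using J by auto
  show "J k \<subseteq> (\<lambda>x. x $ k) ` V"
  proof
    fix t assume t: "t \<in> J k"
    let ?x = "\<chi> i. if i = k then t else (a $ i + b $ i) / 2"
    have "(a $ i + b $ i) / 2 \<in> J i" for i
      using J(1)[of i] J(3)[of i] by (auto simp: subset_iff)
    then have "?x \<in> V" using t J(2) by auto
    then show "t \<in> (\<lambda>x. x $ k) ` V" by (rule rev_image_eqI) simp
  qed
qed

text \<open>The projection is squeezed between an open and a closed interval with the same end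
  points, so \<open>side\<close> does not see which faces belong to the cell.\<close>

lemma
  assumes "cell a b V"
  shows cell_INF: "(INF x\<in>V. x $ k) = a $ k" and cell_SUP: "(SUP x\<in>V. x $ k) = b $ k"
proof -
  obtain J where J: "\<And>k. a $ k < b $ k" "V = {x. \<forall>k. x $ k \<in> J k}"
    "\<And>k. {a $ k<..<b $ k} \<subseteq> J k" "\<And>k. J k \<subseteq> {a $ k..b $ k}"
    using assms by (elim cellE) (rule that)
  note im = cell_coordinate_image[of a b, OF J(1-3)]
  have ne: "{a $ k<..<b $ k} \<noteq> {}" using J(1)[of k] by simp
  have bdd: "bdd_below (J k)" "bdd_above (J k)"
    by (rule bdd_below_mono[OF bdd_below_Icc J(4)] bdd_above_mono[OF bdd_above_Icc J(4)])+
  have "Inf (J k) \<le> Inf {a $ k<..<b $ k}" by (rule cInf_superset_mono[OF ne bdd(1) J(3)])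
  moreover have "a $ k \<le> Inf (J k)"
    using J(3,4)[of k] ne by (intro cInf_greatest) auto
  ultimately show "(INF x\<in>V. x $ k) = a $ k" using J(1)[of k] by (simp add: im)
  have "Sup {a $ k<..<b $ k} \<le> Sup (J k)" by (rule cSup_subset_mono[OF ne bdd(2) J(3)])
  moreover have "Sup (J k) \<le> b $ k"
    using J(3,4)[of k] ne by (intro cSup_least) auto
  ultimately show "(SUP x\<in>V. x $ k) = b $ k" using J(1)[of k] by (simp add: im)
qed

lemma cell_bounds:
  assumes "cell a b V" "V \<subseteq> unit_cube"
  shows "0 \<le> a $ k" "b $ k \<le> 1"
proof -
  have "0 \<le> (INF x\<in>V. x $ k)" "(SUP x\<in>V. x $ k) \<le> 1"
    using assms(2) cell_nonempty[OF assms(1)]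
    by (auto simp: mem_box_cart subset_iff intro!: cINF_greatest cSUP_least)
  then show "0 \<le> a $ k" "b $ k \<le> 1"
    by (simp_all add: cell_INF[OF assms(1)] cell_SUP[OF assms(1)])
qed

lemma cell_side: "cell a b V \<Longrightarrow> side V k = b $ k - a $ k"
  by (simp add: side_def cell_INF cell_SUP)

lemma h_min_le_side: "h_min V \<le> side V k"
  unfolding h_min_def by (rule Min_le) auto

lemma side_le_h_max: "side V k \<le> h_max V"
  unfolding h_max_def by (rule Max_ge) auto

lemma cell_h_min_pos: "cell a b V \<Longrightarrow> 0 < h_min V"
  by (auto simp: h_min_def cell_side cell_def)

lemma cell_cut_point:
  assumes "cell a b V" "s \<in> splits"
  shows "a $ fst s < cut_point V s" "cut_point V s < b $ fst s"
proof -
  have ab: "a $ fst s < b $ fst s" using assms(1) by (auto simp: cell_def)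
  have s: "0 < snd s" "snd s < 1" using assms(2) by (auto simp: splits_def)
  have "0 < snd s * (b $ fst s - a $ fst s)" "0 < (1 - snd s) * (b $ fst s - a $ fst s)"
    using ab s by simp_all
  then show "a $ fst s < cut_point V s" "cut_point V s < b $ fst s"
    unfolding cut_point_def cell_INF[OF assms(1)] cell_side[OF assms(1)]
    by (simp_all only: algebra_simps)
qed

lemma cell_left_child:
  assumes "cell a b V" "s \<in> splits"
  shows "\<exists>b'. cell a b' (left_child cl V s)"
proof -
  define p c where "p = fst s" and "c = cut_point V s"
  note c = cell_cut_point[OF assms, folded p_def c_def]
  obtain J where J: "\<And>k. a $ k < b $ k" "V = {x. \<forall>k. x $ k \<in> J k}"
    "\<And>k. {a $ k<..<b $ k} \<subseteq> J k" "\<And>k. J k \<subseteq> {a $ k..b $ k}"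
    using assms(1) by (elim cellE) (rule that)
  \<comment> \<open>Only the interval of the split coordinate changes; the tie rule decides whether
    it contains its new end point \<open>c\<close>.\<close>
  let ?J = "\<lambda>k. if k = p then {t \<in> J p. t < c \<or> cl V s \<and> t = c} else J k"
  have "left_child cl V s = {x. \<forall>k. x $ k \<in> ?J k}"
    unfolding left_child_def p_def[symmetric] c_def[symmetric]
    by (auto simp: J(2) split: if_splits)
  moreover have "{a $ k<..<(if k = p then c else b $ k)} \<subseteq> ?J k"
      "?J k \<subseteq> {a $ k..(if k = p then c else b $ k)}" for k
    using J(3)[of k] J(4)[of k] c by (force simp: subset_iff)+
  ultimately have "cell a (\<chi> k. if k = p then c else b $ k) (left_child cl V s)"
    using J(1) c by (intro cellI[where J = ?J]) simp_all
  then show ?thesis ..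
qed

lemma cell_right_child:
  assumes "cell a b V" "s \<in> splits"
  shows "\<exists>a'. cell a' b (right_child cl V s)"
proof -
  define p c where "p = fst s" and "c = cut_point V s"
  note c = cell_cut_point[OF assms, folded p_def c_def]
  obtain J where J: "\<And>k. a $ k < b $ k" "V = {x. \<forall>k. x $ k \<in> J k}"
    "\<And>k. {a $ k<..<b $ k} \<subseteq> J k" "\<And>k. J k \<subseteq> {a $ k..b $ k}"
    using assms(1) by (elim cellE) (rule that)
  let ?J = "\<lambda>k. if k = p then {t \<in> J p. \<not> (t < c \<or> cl V s \<and> t = c)} else J k"
  have "right_child cl V s = {x. \<forall>k. x $ k \<in> ?J k}"
    unfolding right_child_def left_child_def p_def[symmetric] c_def[symmetric]
    by (auto simp: J(2) split: if_splits)
  moreover have "{(if k = p then c else a $ k)<..<b $ k} \<subseteq> ?J k"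
      "?J k \<subseteq> {(if k = p then c else a $ k)..b $ k}" for k
    using J(3)[of k] J(4)[of k] c by (force simp: subset_iff)+
  ultimately have "cell (\<chi> k. if k = p then c else a $ k) b (right_child cl V s)"
    using J(1) c by (intro cellI[where J = ?J]) simp_all
  then show ?thesis ..
qed

lemma cell_children:
  "\<lbrakk>cell a b V; s \<in> splits; W \<in> children cl V s\<rbrakk> \<Longrightarrow> \<exists>a' b'. cell a' b' W"
  unfolding children_def using cell_left_child cell_right_child by blast

section \<open>Invariants of the refinement procedure\<close>

text \<open>The sample count keeps the noise average small, and the aspect ratio turns a bound on
  the smallest side into one on the diameter.\<close>

definition tree_cell ::
  "nat \<Rightarrow> (nat \<Rightarrow> real ^ 'd) \<Rightarrow> real \<Rightarrow> nat \<Rightarrow> (real ^ 'd) set \<Rightarrow> bool" where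
  "tree_cell n x \<beta> m V \<longleftrightarrow>
     (\<exists>a b. cell a b V) \<and> V \<subseteq> unit_cube \<and> m \<le> num_points n x V \<and> h_max V \<le> \<beta> * h_min V"

lemma tree_cell_child:
  assumes "tree_cell n x \<beta> m V" "s \<in> S_beta cl \<beta> V \<inter> S_m cl n x m V" "W \<in> children cl V s"
  shows "tree_cell n x \<beta> m W"
proof -
  have "W \<subseteq> V" using assms(3) by (auto simp: children_def left_child_def right_child_def)
  then show ?thesis
    using assms cell_children[of _ _ V s W] by (auto simp: tree_cell_def S_beta_def S_m_def)
qed

text \<open>Keeping this property for each point makes the definite description in
  \<open>cell_of\<close> meaningful. A cell of \<open>P'\<close> containing \<open>z\<close>
  descends from the cell of \<open>P\<close> containing \<open>z\<close>, and two children are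
  complementary in their parent.\<close>

lemma cart_step_ex1_cell:
  assumes "cart_step cl n x \<beta> m c P P'" "\<exists>!V. V \<in> P \<and> z \<in> V"
  shows "\<exists>!V. V \<in> P' \<and> z \<in> V"
proof -
  obtain sel where P': "P' = (\<Union>V\<in>P. if S_m cl n x m V = {} then {V} else children cl V (sel V))"
    using assms(1) by (auto simp: cart_step_def)
  obtain V where V: "V \<in> P" "z \<in> V" "\<And>U. U \<in> P \<Longrightarrow> z \<in> U \<Longrightarrow> U = V" using assms(2) by blast
  let ?C = "\<lambda>V. if S_m cl n x m V = {} then {V} else children cl V (sel V)"
  have sub: "W \<subseteq> U" if "W \<in> ?C U" for W U
    using that by (auto simp: children_def left_child_def right_child_def split: if_splits)
  have "W \<in> P' \<and> z \<in> W \<longleftrightarrow> W \<in> ?C V \<and> z \<in> W" for W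
    using V sub unfolding P' by blast
  moreover have "\<exists>!W. W \<in> ?C V \<and> z \<in> W"
    using V(2) by (auto simp: children_def right_child_def)
  ultimately show ?thesis by simp
qed

lemma cart_step_tree_cell:
  assumes "cart_step cl n x \<beta> m c P P'" "\<forall>V\<in>P. tree_cell n x \<beta> m V"
  shows "\<forall>V\<in>P'. tree_cell n x \<beta> m V"
proof -
  obtain sel where sel: "\<And>V. V \<in> P \<Longrightarrow> S_m cl n x m V \<noteq> {} \<Longrightarrow>
      sel V \<in> S_beta cl \<beta> V \<inter> S_m cl n x m V"
    and P': "P' = (\<Union>V\<in>P. if S_m cl n x m V = {} then {V} else children cl V (sel V))"
    using assms(1) by (auto simp: cart_step_def is_arg_min_def)
  show ?thesis
  proof
    fix W assume "W \<in> P'"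
    then obtain V where "V \<in> P" "W \<in> (if S_m cl n x m V = {} then {V} else children cl V (sel V))"
      unfolding P' by blast
    then show "tree_cell n x \<beta> m W"
      using assms(2) sel[of V] tree_cell_child[of n x \<beta> m V "sel V" cl W] by (auto split: if_splits)
  qed
qed

lemma num_points_eq_card: "num_points n x V = card {i \<in> {1..n}. x i \<in> V}"
  unfolding num_points_def indicator_def by (simp add: sum.If_cases Int_def)

lemma num_points_mono: "V \<subseteq> W \<Longrightarrow> num_points n x V \<le> num_points n x W"
  unfolding num_points_eq_card by (rule card_mono) auto

lemma tree_cell_unit_cube:
  assumes "\<forall>i\<in>{1..n}. x i \<in> unit_cube" "m \<le> n" "1 \<le> \<beta>"
  shows "tree_cell n x \<beta> m (unit_cube :: (real ^ 'd) set)"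
proof -
  have "{i \<in> {1..n}. x i \<in> unit_cube} = {1..n}" using assms(1) by auto
  then have "num_points n x unit_cube = n" unfolding num_points_eq_card by simp
  moreover have "side (unit_cube :: (real ^ 'd) set) k = 1" for k
    by (simp add: cell_side[OF cell_unit_cube])
  ultimately show ?thesis
    unfolding tree_cell_def h_max_def h_min_def using cell_unit_cube assms(2,3) by auto
qed

text \<open>Both invariants are carried through the reachable partitions together; uniqueness of the
  cell of \<open>z\<close> then evaluates \<open>cell_of\<close>, and termination supplies the empty
  \<open>S_m\<close>.\<close>

lemma cart_partition_cell:
  assumes "cart_partition cl n x \<beta> m c P" "\<forall>i\<in>{1..n}. x i \<in> unit_cube" "m \<le> n" "1 \<le> \<beta>"
    and "z \<in> unit_cube"
  shows "tree_cell n x \<beta> m (cell_of P z)" "S_m cl n x m (cell_of P z) = {}" "z \<in> cell_of P z"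
proof -
  have reach: "(cart_step cl n x \<beta> m c)\<^sup>*\<^sup>* {unit_cube} P" and final: "\<forall>V\<in>P. S_m cl n x m V = {}"
    using assms(1) by (auto simp: cart_partition_def)
  from reach have "(\<forall>V\<in>P. tree_cell n x \<beta> m V) \<and> (\<exists>!V. V \<in> P \<and> z \<in> V)"
  proof (induction rule: rtranclp_induct)
    case base
    then show ?case using tree_cell_unit_cube[OF assms(2-4)] assms(5) by auto
  next
    case (step P P')
    then show ?case
      using cart_step_ex1_cell[OF step.hyps(2)] cart_step_tree_cell[OF step.hyps(2)] by simp
  qed
  moreover from this have "cell_of P z \<in> P \<and> z \<in> cell_of P z"
    unfolding cell_of_def using theI'[of "\<lambda>V. V \<in> P \<and> z \<in> V"] by blast
  ultimately show "tree_cell n x \<beta> m (cell_of P z)" "S_m cl n x m (cell_of P z) = {}" "z \<in> cell_of P z"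
    using final by blast+
qed

section \<open>Sample count of a final cell\<close>

text \<open>The cut is the midpoint between the \<open>m\<close>-th and the
  \<open>(m + 1)\<close>-st smallest element, which have indices \<open>m - 1\<close> and
  \<open>m\<close> in the sorted list. The elements \<open>p\<close> and \<open>q\<close> on either
  side serve to place \<open>c\<close> strictly inside the cell.\<close>

lemma finite_set_cut:
  fixes S :: "real set"
  assumes "finite S" "0 < m" "2 * m \<le> card S"
  obtains c p q where "m \<le> card {x \<in> S. x < c}" "m \<le> card {x \<in> S. c < x}"
    "p \<in> S" "q \<in> S" "p < c" "c < q"
proof -
  define l where "l = sorted_list_of_set S"
  have l: "set l = S" "length l = card S" "sorted_wrt (<) l"
    using assms(1) by (auto simp: l_def)
  define c where "c = (l ! (m - 1) + l ! m) / 2"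
  have mid: "l ! (m - 1) < l ! m"
    using sorted_wrt_nth_less[OF l(3), of "m - 1" m] assms l by simp
  have le: "l ! i \<le> l ! j" if "i \<le> j" "j < length l" for i j
    using sorted_wrt_nth_less[OF l(3), of i j] that by (cases "i = j") auto
  have inj: "inj_on ((!) l) {..<length l}"
    using l(3) by (simp add: inj_on_nth strict_sorted_iff)
  have "(!) l ` {..<m} \<subseteq> {x \<in> S. x < c}"
  proof safe
    fix i assume "i < m"
    then have "l ! i \<le> l ! (m - 1)" "i < length l" using le[of i "m - 1"] assms l by auto
    then show "l ! i \<in> S" "l ! i < c" using mid l by (auto simp: c_def)
  qed
  then have "card ((!) l ` {..<m}) \<le> card {x \<in> S. x < c}"
    using assms(1) by (intro card_mono) auto
  also have "card ((!) l ` {..<m}) = m"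
    using inj assms l by (subst card_image) (auto intro: inj_on_subset)
  finally have left: "m \<le> card {x \<in> S. x < c}" .
  have "(!) l ` {m..<length l} \<subseteq> {x \<in> S. c < x}"
  proof safe
    fix i assume "i \<in> {m..<length l}"
    then show "l ! i \<in> S" "c < l ! i"
      using le[of m i] mid assms l by (auto simp: c_def)
  qed
  then have "card ((!) l ` {m..<length l}) \<le> card {x \<in> S. c < x}"
    using assms(1) by (intro card_mono) auto
  moreover have "card ((!) l ` {m..<length l}) = length l - m"
    using inj by (subst card_image) (auto intro: inj_on_subset)
  ultimately have right: "m \<le> card {x \<in> S. c < x}" using l(2) assms(3) by simp
  have "l ! (m - 1) \<in> S" "l ! m \<in> S" using assms l by auto
  then show thesis using that[OF left right] mid by (auto simp: c_def)
qed

text \<open>A cut strictly between two of the distinct \<open>k\<close>-th coordinates of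
  \<open>2 * m\<close> points leaves \<open>m\<close> of them on each side, whatever the tie rule.
  \<open>S_m\<close> puts no condition on the aspect ratio, so it contains this split for any
  \<open>k\<close>.\<close>

lemma num_points_final_cell_less:
  fixes x :: "nat \<Rightarrow> real ^ 'd"
  assumes V: "cell a b V" and final: "S_m cl n x m V = {}" and m: "0 < m"
    and inj: "inj_on (\<lambda>i. x i $ k) {1..n}"
  shows "num_points n x V < 2 * m"
proof (rule ccontr)
  assume "\<not> ?thesis"
  then have ge: "2 * m \<le> card {i \<in> {1..n}. x i \<in> V}" by (simp add: num_points_eq_card)
  define T where "T = {i \<in> {1..n}. x i \<in> V}"
  have injT: "inj_on (\<lambda>i. x i $ k) T" using inj by (rule inj_on_subset) (auto simp: T_def)
  define S where "S = (\<lambda>i. x i $ k) ` T"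
  have "finite S" "2 * m \<le> card S"
    using ge injT by (auto simp: S_def card_image T_def)
  then obtain c p q where c: "m \<le> card {t \<in> S. t < c}" "m \<le> card {t \<in> S. c < t}"
    "p \<in> S" "q \<in> S" "p < c" "c < q"
    using m finite_set_cut by blast
  have S_sub: "S \<subseteq> {a $ k..b $ k}"
    using cell_subset_cbox[OF V] by (auto simp: S_def T_def mem_box_cart)
  then have ab: "a $ k < c" "c < b $ k" using c by auto
  \<comment> \<open>The relative position of \<open>c\<close> in the \<open>k\<close>-th side, so
    that \<open>cut_point\<close> returns exactly \<open>c\<close>.\<close>
  define s where "s = (k, (c - a $ k) / (b $ k - a $ k))"
  have s: "s \<in> splits" using ab by (auto simp: s_def splits_def field_simps)
  have cut: "cut_point V s = c"
    using ab by (simp add: s_def cut_point_def cell_INF[OF V] cell_side[OF V])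
  have fs: "fst s = k" by (simp add: s_def)
  have "card {i \<in> T. x i $ k < c} = card {t \<in> S. t < c}"
    by (rule bij_betw_same_card[where f="\<lambda>i. x i $ k"])
       (auto simp: bij_betw_def S_def intro: inj_on_subset[OF injT])
  moreover have "card {i \<in> T. x i $ k < c} \<le> num_points n x (left_child cl V s)"
    unfolding num_points_eq_card left_child_def fs cut by (rule card_mono) (auto simp: T_def)
  moreover have "card {i \<in> T. c < x i $ k} = card {t \<in> S. c < t}"
    by (rule bij_betw_same_card[where f="\<lambda>i. x i $ k"])
       (auto simp: bij_betw_def S_def intro: inj_on_subset[OF injT])
  moreover have "card {i \<in> T. c < x i $ k} \<le> num_points n x (right_child cl V s)"
    unfolding num_points_eq_card right_child_def left_child_def fs cut
    by (rule card_mono) (auto simp: T_def)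
  ultimately have "s \<in> S_m cl n x m V"
    using s c(1,2) by (auto simp: S_m_def children_def)
  then show False using final by blast
qed

section \<open>Oscillation of a Lipschitz function on a cell\<close>

text \<open>Every admissible constant dominates the difference quotient, hence so does the infimum.
  The constant \<open>L\<close> shows that the infimum is over a nonempty set and not a default
  value.\<close>

lemma lip_const_bound:
  assumes L: "L-lipschitz_on U g" "V \<subseteq> U" and "y \<in> V" "z \<in> V"
  shows "\<bar>g y - g z :: real\<bar> \<le> lip_const g V * dist y z"
proof (cases "y = z")
  case False
  have ne: "L \<in> {C. C-lipschitz_on V g}" using lipschitz_on_subset[OF L] by simp
  have "\<bar>g y - g z\<bar> / dist y z \<le> C" if "C-lipschitz_on V g" for C
    using lipschitz_onD[OF that assms(3,4)] False by (simp add: dist_real_def field_simps)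
  then have "\<bar>g y - g z\<bar> / dist y z \<le> lip_const g V"
    unfolding lip_const_def using ne by (intro cInf_greatest) auto
  then show ?thesis using False by (simp add: field_simps)
qed simp

lemma lip_const_nonneg:
  assumes "L-lipschitz_on U g" "V \<subseteq> U"
  shows "0 \<le> lip_const g V"
  unfolding lip_const_def
  using lipschitz_on_subset[OF assms] by (intro cInf_greatest) (auto dest: lipschitz_on_nonneg)

lemma dist_cell_le:
  fixes V :: "(real ^ 'd) set"
  assumes V: "cell a b V" and "y \<in> V" "z \<in> V"
  shows "dist y z \<le> sqrt (real CARD('d)) * h_max V"
proof -
  have k: "(y $ k - z $ k)\<^sup>2 \<le> (h_max V)\<^sup>2" for k
  proof -
    have "y \<in> cbox a b" "z \<in> cbox a b" using cell_subset_cbox[OF V] assms(2,3) by auto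
    then have "\<bar>y $ k - z $ k\<bar> \<le> h_max V"
      using side_le_h_max[of V k] cell_side[OF V, of k]
      by (auto simp: mem_box_cart) (smt (verit))
    then show ?thesis by (metis abs_ge_zero power2_abs power_mono)
  qed
  have "0 \<le> h_max V"
    using cell_h_min_pos[OF V] h_min_le_side[of V undefined] side_le_h_max[of V undefined] by linarith
  have "dist y z = sqrt (\<Sum>k\<in>UNIV. (y $ k - z $ k)\<^sup>2)"
    by (simp add: dist_norm norm_vec_def L2_set_def)
  also have "\<dots> \<le> sqrt (\<Sum>k\<in>(UNIV::'d set). (h_max V)\<^sup>2)"
    by (intro real_sqrt_le_mono sum_mono k)
  also have "\<dots> = sqrt (real CARD('d)) * h_max V"
    using \<open>0 \<le> h_max V\<close> by (simp add: real_sqrt_mult)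
  finally show ?thesis .
qed

section \<open>Grid boxes and the smallest side of a final cell\<close>

text \<open>Indices up to \<open>2 * n\<close> span the unit interval and give
  \<open>2 * n + 1\<close> values per coordinate, the base in the union bound. The boxes are open so
  that containment in a cell does not depend on its faces.\<close>

definition grid_box :: "nat \<Rightarrow> ('d \<Rightarrow> nat) \<Rightarrow> ('d \<Rightarrow> nat) \<Rightarrow> (real ^ 'd) set" where
  "grid_box n p q = box (\<chi> k. real (p k) / (2 * real n)) (\<chi> k. real (q k) / (2 * real n))"

text \<open>Rounding inwards moves each face by less than one mesh width, so a side loses at most
  \<open>1 / n\<close>. The condition on \<open>h_min V\<close> keeps the trimmed sides nonnegative,
  so that the volume is their product.\<close>

lemma cell_contains_grid_box:
  fixes V :: "(real ^ 'd) set"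
  assumes V: "cell a b V" "V \<subseteq> unit_cube" and n: "0 < n" and h: "1 / n \<le> h_min V"
  obtains p q where "\<And>k. p k \<le> 2 * n" "\<And>k. q k \<le> 2 * n" "grid_box n p q \<subseteq> V"
    "(h_min V - 1 / n) ^ CARD('d) \<le> measure lborel (grid_box n p q)"
proof -
  have ab: "a $ k < b $ k" for k using V by (auto simp: cell_def)
  have a0: "0 \<le> a $ k" and b1: "b $ k \<le> 1" for k
    using cell_bounds[OF V] by auto
  \<comment> \<open>\<open>nat\<close> loses nothing here: both rounded values are nonnegative
    because the corners are.\<close>
  define p q where "p k = nat \<lceil>a $ k * (2 * n)\<rceil>" and "q k = nat \<lfloor>b $ k * (2 * n)\<rfloor>" for k
  have b0: "0 \<le> b $ k" and a1: "a $ k \<le> 1" for k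
    using a0[of k] ab[of k] b1[of k] by linarith+
  have p: "a $ k * (2 * n) \<le> p k" "p k < a $ k * (2 * n) + 1" for k
    using a0[of k] unfolding p_def by (auto simp: of_nat_nat) linarith+
  have q: "q k \<le> b $ k * (2 * n)" "b $ k * (2 * n) - 1 < q k" for k
    using b0[of k] unfolding q_def by (auto simp: of_nat_nat)
  have "real (q k) \<le> 2 * n" for k
    using q(1)[of k] mult_right_mono[OF b1[of k], of "2 * real n"] by simp
  then have q_le: "q k \<le> 2 * n" for k by (metis of_nat_le_iff of_nat_mult of_nat_numeral)
  have "a $ k * (2 * n) \<le> of_int (int (2 * n))" for k
    using mult_right_mono[OF a1[of k], of "2 * real n"] by simp
  then have "\<lceil>a $ k * (2 * n)\<rceil> \<le> int (2 * n)" for k by (rule ceiling_le)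
  then have p_le: "p k \<le> 2 * n" for k unfolding p_def by (simp add: nat_le_iff)
  let ?p = "\<chi> k. real (p k) / (2 * real n)" and ?q = "\<chi> k. real (q k) / (2 * real n)"
  have sub: "grid_box n p q \<subseteq> V"
  proof -
    have "a $ k \<le> ?p $ k" "?q $ k \<le> b $ k" for k
      using p(1)[of k] q(1)[of k] n by (auto simp: field_simps)
    then have "box ?p ?q \<subseteq> box a b"
      unfolding subset_iff mem_box_cart by (meson le_less_trans less_le_trans)
    then show ?thesis unfolding grid_box_def using box_subset_cell[OF V(1)] by blast
  qed
  have w: "h_min V - 1 / n \<le> ?q $ k - ?p $ k" for k
  proof -
    have "h_min V \<le> b $ k - a $ k" using h_min_le_side[of V k] by (simp add: cell_side[OF V(1)])
    then have "h_min V * (2 * n) \<le> (b $ k - a $ k) * (2 * n)" by (rule mult_right_mono) simp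
    then have "h_min V * (2 * n) - 2 \<le> real (q k) - real (p k)"
      using p(2)[of k] q(2)[of k] by (simp add: algebra_simps)
    then have "(h_min V * (2 * n) - 2) / (2 * n) \<le> (real (q k) - real (p k)) / (2 * n)"
      by (rule divide_right_mono) simp
    then show ?thesis using n by (simp add: diff_divide_distrib)
  qed
  have "0 \<le> ?q $ k - ?p $ k" for k using w[of k] h by linarith
  then have pq: "cbox ?p ?q \<noteq> {}" by (simp add: interval_ne_empty_cart)
  have "(h_min V - 1 / n) ^ CARD('d) = (\<Prod>k\<in>(UNIV :: 'd set). h_min V - 1 / n)" by simp
  also have "\<dots> \<le> (\<Prod>k\<in>UNIV. ?q $ k - ?p $ k)" by (intro prod_mono) (use w h in auto)
  also have "\<dots> = measure lborel (grid_box n p q)"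
    using content_cbox_cart[OF pq] by (simp add: grid_box_def measure_lborel_cbox_eq measure_lborel_box_eq)
  finally show thesis using that p_le q_le sub by blast
qed

text \<open>If \<open>h ^ d\<close> were larger, a trimmed box of volume at least
  \<open>h ^ d - d / n\<close> would fit into the cell. Multiplied by \<open>n * \<kappa>\<close>,
  this volume is at least \<open>5 * m - \<kappa> * d\<close>, and the fifth \<open>m\<close> pays
  for \<open>\<kappa> * d\<close>. Then \<open>grid\<close> puts more than \<open>2 * m\<close>
  points into the cell, against \<open>few\<close>.\<close>

lemma h_min_final_cell_le:
  fixes V :: "(real ^ 'd) set" and \<kappa> :: real
  assumes V: "cell a b V" "V \<subseteq> unit_cube" and n: "0 < n" and \<kappa>: "0 < \<kappa>" "\<kappa> \<le> 1"
    and m: "CARD('d) \<le> m" and few: "num_points n x V < 2 * m"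
    and grid: "\<forall>p q. (\<forall>k. p k \<le> 2 * n) \<and> (\<forall>k. q k \<le> 2 * n) \<and> grid_box n p q \<subseteq> unit_cube \<and>
      4 * real m \<le> real n * (\<kappa> * measure lborel (grid_box n p q)) \<longrightarrow>
      2 * m < num_points n x (grid_box n p q)"
  shows "h_min V \<le> (5 * real m / (real n * \<kappa>)) powr (1 / real CARD('d))"
proof -
  define h d where "h = h_min V" and "d = CARD('d)"
  have d: "0 < d" by (simp add: d_def)
  have h0: "0 < h" unfolding h_def by (rule cell_h_min_pos[OF V(1)])
  have h1: "h \<le> 1"
    using h_min_le_side[of V undefined] cell_bounds[OF V, of undefined] cell_side[OF V(1), of undefined]
    by (simp add: h_def)
  have hd: "h ^ d \<le> h" using power_decreasing[of 1 d h] h0 h1 d by simp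
  have "h ^ d \<le> 5 * real m / (real n * \<kappa>)"
  proof (rule ccontr)
    assume "\<not> ?thesis"
    then have gt: "5 * real m < real n * \<kappa> * h ^ d"
      using n \<kappa> by (simp add: field_simps)
    \<comment> \<open>As \<open>h \<le> 1\<close>, the assumed excess also forces
      \<open>n * h\<close> above \<open>1\<close>, so that trimming by \<open>1 / n\<close> is
      possible.\<close>
    have "real n * \<kappa> * h ^ d \<le> real n * 1 * h"
      using \<kappa> hd h0 by (intro mult_mono) auto
    moreover have "1 \<le> real m" using m zero_less_card_finite[where 'a='d] by linarith
    ultimately have nh: "1 \<le> real n * h" using gt by simp
    then have hn: "1 / n \<le> h" using n by (simp add: field_simps)
    then obtain p q where pq: "\<And>k. p k \<le> 2 * n" "\<And>k. q k \<le> 2 * n" "grid_box n p q \<subseteq> V"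
      "(h - 1 / n) ^ d \<le> measure lborel (grid_box n p q)"
      using cell_contains_grid_box[OF V n] unfolding h_def d_def by metis
    \<comment> \<open>Factor out \<open>h\<close> and apply Bernoulli's inequality to
      \<open>1 - 1 / (n * h)\<close>; the loss \<open>h ^ d / h * (d / n)\<close> is at most
      \<open>d / n\<close> since \<open>h ^ d \<le> h\<close>.\<close>
    have "h ^ d - d / n \<le> (h - 1 / n) ^ d"
    proof -
      have "- 1 \<le> - (1 / (n * h))" using nh h0 n by (simp add: field_simps)
      from Bernoulli_inequality[OF this, of d]
      have bern: "1 - d / (n * h) \<le> (1 - 1 / (n * h)) ^ d" by simp
      have eq1: "h * (1 - 1 / (n * h)) = h - 1 / n" using h0 n by (simp add: field_simps)
      have eq2: "h ^ d * (1 - d / (n * h)) = h ^ d - (h ^ d / h) * (d / n)"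
        by (simp add: right_diff_distrib mult_ac)
      have "h ^ d * (1 - d / (n * h)) \<le> h ^ d * (1 - 1 / (n * h)) ^ d"
        using h0 by (intro mult_left_mono[OF bern]) simp
      then have "h ^ d - (h ^ d / h) * (d / n) \<le> (h - 1 / n) ^ d"
        unfolding eq2 by (simp only: power_mult_distrib[symmetric] eq1)
      moreover have "(h ^ d / h) * (d / n) \<le> 1 * (d / n)"
        using hd h0 by (intro mult_right_mono) auto
      ultimately show ?thesis by simp
    qed
    then have "real n * \<kappa> * (h ^ d - d / n) \<le> real n * \<kappa> * measure lborel (grid_box n p q)"
      using pq(4) \<kappa> by (intro mult_left_mono) auto
    moreover have "real n * \<kappa> * (h ^ d - d / n) = real n * \<kappa> * h ^ d - \<kappa> * d"
      using n by (simp add: field_simps)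
    moreover have "\<kappa> * d \<le> 1 * real m" using \<kappa> m by (intro mult_mono) (auto simp: d_def)
    ultimately have "4 * real m \<le> real n * (\<kappa> * measure lborel (grid_box n p q))"
      using gt by (simp add: mult.assoc)
    then have "2 * m < num_points n x (grid_box n p q)"
      using grid pq(1-3) V(2) by blast
    then show False using num_points_mono[OF pq(3), of n x] few by simp
  qed
  then have "(h ^ d) powr (1 / d) \<le> (5 * real m / (real n * \<kappa>)) powr (1 / d)"
    using h0 by (intro powr_mono2) auto
  moreover have "(h ^ d) powr (1 / d) = h"
    using h0 d by (simp add: powr_realpow[symmetric] powr_powr)
  ultimately show ?thesis by (simp add: h_def d_def)
qed

section \<open>Index sets spanned by sample points\<close>

text \<open>\<open>p k\<close> and \<open>q k\<close> name the sample points that bound coordinate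
  \<open>k\<close>. Coding the box by indices instead of real corners leaves a finite family for the
  union bound.\<close>

definition spanned :: "nat \<Rightarrow> ('d \<Rightarrow> nat) \<Rightarrow> ('d \<Rightarrow> nat) \<Rightarrow> (nat \<Rightarrow> real ^ 'd) \<Rightarrow> nat set" where
  "spanned n p q x = {i \<in> {1..n}. \<forall>k. x (p k) $ k \<le> x i $ k \<and> x i $ k \<le> x (q k) $ k}"

text \<open>In each coordinate, take the indices of the smallest and the largest sample value in the
  cell. Order convexity of the cell shows that the spanned box picks up no sample point from
  outside.\<close>

lemma cell_sample_spanned:
  assumes V: "cell a b V" and ne: "0 < num_points n x V"
  shows "\<exists>p q. (\<forall>k. p k \<in> {1..n} \<and> q k \<in> {1..n}) \<and> {i \<in> {1..n}. x i \<in> V} = spanned n p q x"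
proof -
  define T where "T = {i \<in> {1..n}. x i \<in> V}"
  have T: "finite T" "T \<noteq> {}" using ne by (auto simp: T_def num_points_eq_card card_gt_0_iff)
  have "\<exists>i. i \<in> T \<and> (\<forall>j\<in>T. x i $ k \<le> x j $ k)" for k
    using ex_is_arg_min_if_finite[OF T, of "\<lambda>i. x i $ k"] by (auto simp: is_arg_min_linorder)
  then have "\<forall>k. \<exists>i. i \<in> T \<and> (\<forall>j\<in>T. x i $ k \<le> x j $ k)" ..
  then obtain p where p: "\<forall>k. p k \<in> T \<and> (\<forall>j\<in>T. x (p k) $ k \<le> x j $ k)"
    by (rule choice[THEN exE])
  have "\<exists>i. i \<in> T \<and> (\<forall>j\<in>T. x j $ k \<le> x i $ k)" for k
    using ex_is_arg_min_if_finite[OF T, of "\<lambda>i. - x i $ k"] by (auto simp: is_arg_min_linorder)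
  then have "\<forall>k. \<exists>i. i \<in> T \<and> (\<forall>j\<in>T. x j $ k \<le> x i $ k)" ..
  then obtain q where q: "\<forall>k. q k \<in> T \<and> (\<forall>j\<in>T. x j $ k \<le> x (q k) $ k)"
    by (rule choice[THEN exE])
  have "i \<in> T" if i: "i \<in> spanned n p q x" for i
  proof -
    have "x i \<in> V"
    proof (rule cell_order_convex[OF V])
      show "x (p k) \<in> V" "x (q k) \<in> V" for k using p q by (simp_all add: T_def)
      show "x (p k) $ k \<le> x i $ k" "x i $ k \<le> x (q k) $ k" for k
        using i by (simp_all add: spanned_def)
    qed
    then show ?thesis using i by (simp add: T_def spanned_def)
  qed
  moreover have "i \<in> spanned n p q x" if "i \<in> T" for i
    using that p q by (simp add: T_def spanned_def)
  ultimately have "T = spanned n p q x" by blast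
  moreover have "p k \<in> {1..n} \<and> q k \<in> {1..n}" for k using p q by (auto simp: T_def)
  ultimately have "(\<forall>k. p k \<in> {1..n} \<and> q k \<in> {1..n}) \<and> T = spanned n p q x" by blast
  then show ?thesis unfolding T_def by (intro exI)
qed

section \<open>Deterministic error bound\<close>

text \<open>All probabilistic input is isolated in hypotheses on one fixed sample, above all
  \<open>inj\<close>, \<open>grid\<close> and \<open>dev\<close>. \<open>\<kappa>\<close> stands for
  the lower bound of the density.\<close>

lemma local_estimator_error:
  fixes x :: "nat \<Rightarrow> real ^ 'd" and y :: "nat \<Rightarrow> real" and \<kappa> \<beta> s :: real
  assumes P: "cart_partition cl n x \<beta> m c P" "\<forall>i\<in>{1..n}. x i \<in> unit_cube" "m \<le> n" "1 \<le> \<beta>"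
    and z: "z \<in> unit_cube" and m: "CARD('d) \<le> m"
    and inj: "inj_on (\<lambda>i. x i $ k) {1..n}" and lip: "L-lipschitz_on unit_cube g"
    and \<kappa>: "0 < \<kappa>" "\<kappa> \<le> 1"
    and grid: "\<forall>p q. (\<forall>k. p k \<le> 2 * n) \<and> (\<forall>k. q k \<le> 2 * n) \<and> grid_box n p q \<subseteq> unit_cube \<and>
      4 * real m \<le> real n * (\<kappa> * measure lborel (grid_box n p q)) \<longrightarrow>
      2 * m < num_points n x (grid_box n p q)"
    and dev: "\<forall>p q. (\<forall>k. p k \<in> {1..n}) \<and> (\<forall>k. q k \<in> {1..n}) \<and> m \<le> card (spanned n p q x) \<longrightarrow>
      \<bar>\<Sum>i\<in>spanned n p q x. y i - g (x i)\<bar> \<le> s * card (spanned n p q x)"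
  shows "\<bar>local_estimator n x y P z - g z\<bar>
    \<le> s + lip_const g (cell_of P z) * \<beta> * sqrt (real CARD('d))
        * (5 * real m / (real n * \<kappa>)) powr (1 / real CARD('d))"
proof -
  define V where "V = cell_of P z"
  note cell = cart_partition_cell[OF P z, folded V_def]
  obtain a b where V: "cell a b V" "V \<subseteq> unit_cube" and mV: "m \<le> num_points n x V"
    and h: "h_max V \<le> \<beta> * h_min V"
    using cell(1) by (auto simp: tree_cell_def)
  have m0: "0 < m" and n0: "0 < n" using m P(3) zero_less_card_finite[where 'a='d] by linarith+
  have few: "num_points n x V < 2 * m"
    by (rule num_points_final_cell_less[OF V(1) cell(2) m0 inj])
  define T where "T = {i \<in> {1..n}. x i \<in> V}"
  have T: "finite T" "m \<le> card T" using mV by (auto simp: T_def num_points_eq_card)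
  then have cT: "0 < real (card T)" using m0 by linarith
  have "0 < num_points n x V" using mV m0 by linarith
  from cell_sample_spanned[OF V(1) this, folded T_def]
  obtain p q where "\<forall>k. p k \<in> {1..n} \<and> q k \<in> {1..n}" "T = spanned n p q x"
    by (elim exE conjE) (rule that)
  then have pq: "\<And>k. p k \<in> {1..n}" "\<And>k. q k \<in> {1..n}" "T = spanned n p q x" by blast+
  have noise: "\<bar>\<Sum>i\<in>T. y i - g (x i)\<bar> \<le> s * card T"
    using dev pq(1,2) T(2) unfolding pq(3) by blast
  let ?r = "lip_const g V * \<beta> * sqrt (real CARD('d)) * (5 * real m / (real n * \<kappa>)) powr (1 / real CARD('d))"
  have bias: "\<bar>g (x i) - g z\<bar> \<le> ?r" if "i \<in> T" for i
  proof -
    have xi: "x i \<in> V" using that by (simp add: T_def)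
    have L0: "0 \<le> lip_const g V" by (rule lip_const_nonneg[OF lip V(2)])
    have "\<bar>g (x i) - g z\<bar> \<le> lip_const g V * dist (x i) z"
      by (rule lip_const_bound[OF lip V(2) xi cell(3)])
    also have "\<dots> \<le> lip_const g V * (sqrt (real CARD('d)) * (\<beta> * (5 * real m / (real n * \<kappa>)) powr (1 / real CARD('d))))"
    proof (intro mult_left_mono L0)
      have "h_max V \<le> \<beta> * (5 * real m / (real n * \<kappa>)) powr (1 / real CARD('d))"
        using mult_left_mono[OF h_min_final_cell_le[OF V n0 \<kappa> m few grid], of \<beta>] h P(4) by linarith
      then show "dist (x i) z \<le> sqrt (real CARD('d)) * (\<beta> * (5 * real m / (real n * \<kappa>)) powr (1 / real CARD('d)))"
        using dist_cell_le[OF V(1) xi cell(3)]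
        by (meson mult_left_mono order_trans real_sqrt_ge_zero of_nat_0_le_iff)
    qed
    finally show ?thesis by (simp add: mult_ac)
  qed
  have "local_estimator n x y P z = (\<Sum>i\<in>T. y i) / card T"
    unfolding local_estimator_def V_def[symmetric] T_def
    by (simp add: indicator_def sum.If_cases Int_def if_distrib[of "(*) _"] cong: if_cong)
  \<comment> \<open>Averaging \<open>g z\<close> over \<open>T\<close> splits the error into mean
    noise and mean bias. The denominator is positive because \<open>card T\<close> is at least
    \<open>m\<close>.\<close>
  then have "local_estimator n x y P z - g z = ((\<Sum>i\<in>T. y i - g (x i)) + (\<Sum>i\<in>T. g (x i) - g z)) / card T"
    using cT by (simp add: sum_subtractf field_simps)
  also have "\<bar>\<dots>\<bar> \<le> (s * card T + (\<Sum>i\<in>T. ?r)) / card T"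
  proof -
    have "\<bar>\<Sum>i\<in>T. g (x i) - g z\<bar> \<le> (\<Sum>i\<in>T. ?r)"
      using bias by (intro order_trans[OF sum_abs] sum_mono)
    then have "\<bar>(\<Sum>i\<in>T. y i - g (x i)) + (\<Sum>i\<in>T. g (x i) - g z)\<bar> \<le> s * card T + (\<Sum>i\<in>T. ?r)"
      using noise by linarith
    then show ?thesis using cT by (simp add: abs_divide divide_right_mono)
  qed
  also have "\<dots> = s + ?r" using cT by (simp add: field_simps)
  finally show ?thesis by (simp add: V_def)
qed

subsection \<open>Conditionally sub-Gaussian sums over random index sets\<close>

text \<open>Given \<open>X\<close>, the normalized exponential has conditional mean at most
  \<open>1\<close>. Testing it against functions of \<open>X\<close> removes the conditional
  expectation, so that the bound is a property of the joint law.\<close>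

lemma cond_mgf_bound:
  fixes X :: "'w \<Rightarrow> 'b::topological_space"
  assumes M: "prob_space M" and X[measurable]: "X \<in> borel_measurable M"
    and e[measurable]: "e \<in> borel_measurable M" and sub: "cond_sub_gaussian M X e v"
    and \<psi>[measurable]: "\<psi> \<in> borel_measurable borel"
  shows "(\<integral>\<^sup>+w. \<psi> (X w) * ennreal (exp (t * e w - t\<^sup>2 * v / 2)) \<partial>M) \<le> (\<integral>\<^sup>+w. \<psi> (X w) \<partial>M)"
proof -
  interpret prob_space M by (rule M)
  let ?F = "sigma_gen M X"
  have "subalgebra M ?F"
    unfolding subalgebra_def sigma_gen_def sets_vimage_algebra2[of X "space M" borel, simplified]
    by auto
  then interpret F: sigma_finite_subalgebra M ?F
    by (intro finite_measure_subalgebra_is_sigma_finite finite_measure_subalgebra.intro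
        finite_measure_axioms finite_measure_subalgebra_axioms.intro)
  have XF: "X \<in> measurable ?F borel"
    unfolding sigma_gen_def by (rule measurable_vimage_algebra1) simp
  \<comment> \<open>Moving this constant to the \<open>X\<close>-measurable factor leaves exactly
    the exponential whose conditional expectation is bounded by assumption.\<close>
  let ?c = "ennreal (exp (- (t\<^sup>2 * v / 2)))"
  have \<psi>F: "(\<lambda>w. \<psi> (X w) * ?c) \<in> borel_measurable ?F"
    using measurable_compose[OF XF \<psi>] by measurable
  have "(\<integral>\<^sup>+w. \<psi> (X w) * ennreal (exp (t * e w - t\<^sup>2 * v / 2)) \<partial>M)
      = (\<integral>\<^sup>+w. \<psi> (X w) * ?c * ennreal (exp (t * e w)) \<partial>M)"
  proof (intro nn_integral_cong)
    fix w
    have "ennreal (exp (t * e w - t\<^sup>2 * v / 2)) = ?c * ennreal (exp (t * e w))"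
      by (subst ennreal_mult[symmetric]) (simp_all add: exp_add[symmetric])
    then show "\<psi> (X w) * ennreal (exp (t * e w - t\<^sup>2 * v / 2)) = \<psi> (X w) * ?c * ennreal (exp (t * e w))"
      by (simp add: mult.assoc)
  qed
  also have "\<dots> = (\<integral>\<^sup>+w. \<psi> (X w) * ?c * nn_cond_exp M ?F (\<lambda>w. ennreal (exp (t * e w))) w \<partial>M)"
    by (rule F.nn_cond_exp_intg[symmetric]) (use \<psi>F in measurable)
  also have "\<dots> \<le> (\<integral>\<^sup>+w. \<psi> (X w) * ?c * ennreal (exp (t\<^sup>2 * v / 2)) \<partial>M)"
  proof (rule nn_integral_mono_AE)
    have "AE w in M. nn_cond_exp M ?F (\<lambda>w. ennreal (exp (t * e w))) w \<le> ennreal (exp (t\<^sup>2 * v / 2))"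
      using sub by (simp add: cond_sub_gaussian_def)
    then show "AE w in M. \<psi> (X w) * ?c * nn_cond_exp M ?F (\<lambda>w. ennreal (exp (t * e w))) w
        \<le> \<psi> (X w) * ?c * ennreal (exp (t\<^sup>2 * v / 2))"
      by eventually_elim (intro mult_left_mono, auto)
  qed
  also have "\<dots> = (\<integral>\<^sup>+w. \<psi> (X w) \<partial>M)"
  proof -
    have "?c * ennreal (exp (t\<^sup>2 * v / 2)) = 1"
      by (subst ennreal_mult[symmetric]) (simp_all add: exp_add[symmetric])
    then show ?thesis by (simp add: mult.assoc)
  qed
  finally show ?thesis .
qed

text \<open>The factors are integrated out one coordinate at a time: whether the factor at \<open>j\<close> is present
  is decided by the first components alone, so it only multiplies \<open>G\<close> by a function of the first
  component.\<close>

lemma nn_integral_PiM_selected_prod_le_1: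
  fixes \<mu> :: "('x::second_countable_topology \<times> 'y::second_countable_topology) measure"
    and G :: "'x \<times> 'y \<Rightarrow> ennreal"
  assumes \<mu>: "prob_space \<mu>" and sets_\<mu>[measurable_cong]: "sets \<mu> = sets borel"
    and G[measurable]: "G \<in> borel_measurable borel"
    and G_le: "\<And>\<psi>. \<psi> \<in> borel_measurable borel \<Longrightarrow>
      (\<integral>\<^sup>+z. \<psi> (fst z) * G z \<partial>\<mu>) \<le> (\<integral>\<^sup>+z. \<psi> (fst z) \<partial>\<mu>)"
    and I: "finite I" and J: "J \<subseteq> I"
    and W[measurable]: "\<And>i. i \<in> I \<Longrightarrow> Measurable.pred (Pi\<^sub>M I (\<lambda>_. borel)) (W i)"
  shows "(\<integral>\<^sup>+z. (\<Prod>i\<in>J. if W i (\<lambda>j\<in>I. fst (z j)) then G (z i) else 1) \<partial>Pi\<^sub>M I (\<lambda>_. \<mu>)) \<le> 1"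
proof -
  interpret \<mu>: prob_space \<mu> by (rule \<mu>)
  interpret product_prob_space "\<lambda>_. \<mu>" I by unfold_locales
  have fst_meas[measurable]: "fst \<in> borel_measurable \<mu>"
    unfolding measurable_cong_sets[OF sets_\<mu> refl] borel_prod[symmetric] by (rule measurable_fst)
  have "finite J" using I J by (rule rev_finite_subset)
  \<comment> \<open>The induction removes factors while the measure stays on all of
    \<open>I\<close>, because every \<open>W i\<close> may inspect all first components.\<close>
  then show ?thesis using J
  proof (induction J)
    case empty
    then show ?case using P.emeasure_space_1 by simp
  next
    case (insert j J)
    then have j: "j \<in> I" "j \<notin> J" "J \<subseteq> I" by auto
    define K where "K = I - {j}"
    have K: "finite K" "j \<notin> K" and IK: "I = insert j K" using I j by (auto simp: K_def)
    let ?fst = "\<lambda>z. \<lambda>i\<in>I. fst (z i)"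
    define T where "T i z = (if W i (?fst z) then G (z i) else 1)" for i z
    have [measurable]: "?fst \<in> measurable (Pi\<^sub>M I (\<lambda>_. \<mu>)) (Pi\<^sub>M I (\<lambda>_. borel))"
      by measurable
    have T_meas: "T i \<in> borel_measurable (Pi\<^sub>M I (\<lambda>_. \<mu>))" if "i \<in> I" for i
      unfolding T_def using that by measurable
    have prod_meas: "(\<lambda>z. \<Prod>i\<in>J'. T i z) \<in> borel_measurable (Pi\<^sub>M (insert j K) (\<lambda>_. \<mu>))"
      if "J' \<subseteq> I" for J'
      using that T_meas unfolding IK[symmetric] by (intro borel_measurable_prod_ennreal) auto
    have step: "(\<integral>\<^sup>+y. (\<Prod>i\<in>insert j J. T i (z(j := y))) \<partial>\<mu>) \<le> (\<integral>\<^sup>+y. (\<Prod>i\<in>J. T i (z(j := y))) \<partial>\<mu>)"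
      if z: "z \<in> space (Pi\<^sub>M K (\<lambda>_. \<mu>))" for z
    proof -
      \<comment> \<open>Freezing the second component at \<open>y0\<close> displays
        \<open>T i (z(j := y))\<close> for \<open>i \<in> J\<close> as a function of
        \<open>fst y\<close>: for these \<open>i\<close> the value \<open>z i\<close> is untouched,
        and \<open>W i\<close> reads first components only.\<close>
      define y0 :: 'y where "y0 = undefined"
      define H where "H x = (\<Prod>i\<in>J. T i (z(j := (x, y0))))" for x
      define w where "w x \<longleftrightarrow> W j (?fst (z(j := (x, y0))))" for x
      have fst_upd: "?fst (z(j := y)) = ?fst (z(j := (fst y, y0)))" for y by (auto simp: fun_eq_iff)
      have T_upd: "T i (z(j := y)) = T i (z(j := (fst y, y0)))" if "i \<in> J" for i y
        using that j unfolding T_def fst_upd[of y] by (auto split: if_splits)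
      have H: "(\<Prod>i\<in>J. T i (z(j := y))) = H (fst y)" for y
        unfolding H_def by (intro prod.cong refl T_upd)
      have T_j: "T j (z(j := y)) = (if w (fst y) then G y else 1)" for y
        unfolding T_def w_def fst_upd[of y] by simp
      have upd[measurable]: "(\<lambda>x. z(j := (x, y0))) \<in> measurable borel (Pi\<^sub>M I (\<lambda>_. \<mu>))"
      proof -
        have "(\<lambda>x. (x, y0)) \<in> measurable borel \<mu>"
          by (simp add: measurable_cong_sets[OF refl sets_\<mu>])
        from measurable_compose[OF this measurable_component_update[OF z K(2)]]
        show ?thesis by (simp add: IK)
      qed
      have [measurable]: "H \<in> borel_measurable borel"
        unfolding H_def using j T_meas
        by (intro borel_measurable_prod_ennreal measurable_compose[OF upd]) auto
      have w_meas[measurable]: "Measurable.pred borel w"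
        unfolding w_def using j(1) by measurable
      \<comment> \<open>The new factor is \<open>G\<close> where \<open>w\<close> holds and
        \<open>1\<close> elsewhere; \<open>G_le\<close> then removes \<open>G\<close> from the first
        part.\<close>
      have "(\<integral>\<^sup>+y. (\<Prod>i\<in>insert j J. T i (z(j := y))) \<partial>\<mu>)
          = (\<integral>\<^sup>+y. (if w (fst y) then H (fst y) else 0) * G y + (if w (fst y) then 0 else H (fst y)) \<partial>\<mu>)"
        by (intro nn_integral_cong)
          (simp add: prod.insert[OF insert.hyps(1,2)] H T_j mult.commute del: fun_upd_apply)
      also have "\<dots> = (\<integral>\<^sup>+y. (if w (fst y) then H (fst y) else 0) * G y \<partial>\<mu>)
          + (\<integral>\<^sup>+y. (if w (fst y) then 0 else H (fst y)) \<partial>\<mu>)"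
        by (rule nn_integral_add) measurable
      also have "\<dots> \<le> (\<integral>\<^sup>+y. (if w (fst y) then H (fst y) else 0) \<partial>\<mu>)
          + (\<integral>\<^sup>+y. (if w (fst y) then 0 else H (fst y)) \<partial>\<mu>)"
        by (intro add_right_mono G_le[of "\<lambda>x. if w x then H x else 0"]) measurable
      also have "\<dots> = (\<integral>\<^sup>+y. H (fst y) \<partial>\<mu>)"
        by (subst nn_integral_add[symmetric]) (auto intro!: nn_integral_cong)
      finally show ?thesis by (simp add: H)
    qed
    have "(\<integral>\<^sup>+z. (\<Prod>i\<in>insert j J. T i z) \<partial>Pi\<^sub>M I (\<lambda>_. \<mu>))
        = (\<integral>\<^sup>+z. (\<integral>\<^sup>+y. (\<Prod>i\<in>insert j J. T i (z(j := y))) \<partial>\<mu>) \<partial>Pi\<^sub>M K (\<lambda>_. \<mu>))"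
      unfolding IK by (rule product_nn_integral_insert[OF K prod_meas]) (use insert.prems in simp)
    also have "\<dots> \<le> (\<integral>\<^sup>+z. (\<integral>\<^sup>+y. (\<Prod>i\<in>J. T i (z(j := y))) \<partial>\<mu>) \<partial>Pi\<^sub>M K (\<lambda>_. \<mu>))"
      by (rule nn_integral_mono) (rule step)
    also have "\<dots> = (\<integral>\<^sup>+z. (\<Prod>i\<in>J. T i z) \<partial>Pi\<^sub>M I (\<lambda>_. \<mu>))"
      unfolding IK by (rule product_nn_integral_insert[OF K prod_meas, symmetric]) (use j(3) in simp)
    also have "\<dots> \<le> 1" unfolding T_def by (rule insert.IH[OF j(3)])
    finally show ?case unfolding T_def .
  qed
qed

section \<open>Tail bounds for sums over selected indices\<close>

text \<open>This covers variance parameter \<open>0\<close>, where no exponent \<open>s / v\<close>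
  is available. By the bounds at \<open>t = 1\<close> and \<open>t = - 1\<close>, the function
  \<open>exp e + exp (- e) - 2\<close> has integral \<open>0\<close>; it is nonnegative and vanishes
  only at \<open>e = 0\<close>.\<close>

lemma AE_eq_0_of_degenerate_mgf:
  assumes \<mu>: "prob_space \<mu>" and e[measurable]: "e \<in> borel_measurable \<mu>"
    and mgf: "\<And>t. (\<integral>\<^sup>+z. ennreal (exp (t * e z)) \<partial>\<mu>) \<le> 1"
  shows "AE z in \<mu>. e z = 0"
proof -
  interpret prob_space \<mu> by (rule \<mu>)
  have amgm: "0 \<le> exp (e z) + exp (- e z) - 2" for z
    using exp_ge_add_one_self[of "e z"] exp_ge_add_one_self[of "- e z"] by linarith
  let ?f = "\<lambda>z. ennreal (exp (e z) + exp (- e z) - 2)"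
  \<comment> \<open>The \<open>2\<close> is added on both sides and cancelled later, since
    subtraction in \<open>ennreal\<close> is truncated.\<close>
  have "(\<integral>\<^sup>+z. ?f z \<partial>\<mu>) + 2 = (\<integral>\<^sup>+z. ?f z + 2 \<partial>\<mu>)"
    by (subst nn_integral_add) (auto simp: emeasure_space_1)
  also have "\<dots> = (\<integral>\<^sup>+z. ennreal (exp (1 * e z)) + ennreal (exp (- 1 * e z)) \<partial>\<mu>)"
    using amgm by (intro nn_integral_cong) (simp flip: ennreal_plus ennreal_numeral)
  also have "\<dots> = (\<integral>\<^sup>+z. ennreal (exp (1 * e z)) \<partial>\<mu>) + (\<integral>\<^sup>+z. ennreal (exp (- 1 * e z)) \<partial>\<mu>)"
    by (rule nn_integral_add) measurable
  also have "\<dots> \<le> 1 + 1" by (intro add_mono mgf)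
  finally have "(\<integral>\<^sup>+z. ?f z \<partial>\<mu>) + 2 \<le> 0 + 2" by simp
  then have "(\<integral>\<^sup>+z. ?f z \<partial>\<mu>) = 0"
    by (subst (asm) ennreal_add_left_cancel_le[where a=2, unfolded add.commute[of 2]]) auto
  then have "AE z in \<mu>. ?f z = 0" by (subst (asm) nn_integral_0_iff_AE) auto
  then show ?thesis
  proof eventually_elim
    case (elim z)
    then have "exp (e z) + exp (- e z) = 2" using amgm[of z] by (simp add: ennreal_eq_0_iff)
    then have "(exp (e z) - 1)\<^sup>2 = 0" by (simp add: exp_minus field_simps power2_eq_square)
    then show "e z = 0" by simp
  qed
qed

text \<open>Chernoff's method with a correction for each selected term, so that \<open>H\<close> has
  mean at most \<open>1\<close> although the index set is random. On the event, \<open>H\<close> is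
  at least \<open>exp (m * s\<^sup>2 / (2 * v))\<close>, and Markov's inequality applies.\<close>

lemma (in prob_space) selected_sum_tail:
  fixes X :: "nat \<Rightarrow> 'a \<Rightarrow> 'x::second_countable_topology"
    and Y :: "nat \<Rightarrow> 'a \<Rightarrow> 'y::second_countable_topology"
    and e :: "'x \<times> 'y \<Rightarrow> real" and s v :: real
  assumes I: "finite I" "I \<noteq> {}"
    and indep: "indep_vars (\<lambda>_. borel) (\<lambda>i w. (X i w, Y i w)) I"
    and distr: "\<And>i. i \<in> I \<Longrightarrow> distr M borel (\<lambda>w. (X i w, Y i w)) = \<mu>"
    and e[measurable]: "e \<in> borel_measurable borel"
    and mgf: "\<And>\<psi> t. \<psi> \<in> borel_measurable borel \<Longrightarrow>
      (\<integral>\<^sup>+z. \<psi> (fst z) * ennreal (exp (t * e z - t\<^sup>2 * v / 2)) \<partial>\<mu>) \<le> (\<integral>\<^sup>+z. \<psi> (fst z) \<partial>\<mu>)"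
    and W[measurable]: "\<And>i. i \<in> I \<Longrightarrow> Measurable.pred (Pi\<^sub>M I (\<lambda>_. borel)) (W i)"
    and v: "0 < v" and s: "0 \<le> s"
    and S: "\<And>w. S w = {i \<in> I. W i (\<lambda>j\<in>I. X j w)}"
  shows "{w \<in> space M. m \<le> card (S w) \<and> s * card (S w) < (\<Sum>i\<in>S w. e (X i w, Y i w))} \<in> sets M"
      (is "?E \<in> _")
    and "emeasure M {w \<in> space M. m \<le> card (S w) \<and> s * card (S w) < (\<Sum>i\<in>S w. e (X i w, Y i w))}
      \<le> ennreal (exp (- (real m * s\<^sup>2 / (2 * v))))"
proof -
  have Z[measurable]: "(\<lambda>w. (X i w, Y i w)) \<in> borel_measurable M" if "i \<in> I" for i
    using indep that by (auto simp: indep_vars_def)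
  obtain i0 where i0: "i0 \<in> I" using I by auto
  have \<mu>: "prob_space \<mu>" "sets \<mu> = sets borel"
    unfolding distr[OF i0, symmetric] by (auto intro!: prob_space_distr Z i0)
  have fst_b[measurable]: "(fst :: 'x \<times> 'y \<Rightarrow> 'x) \<in> borel_measurable borel"
    unfolding borel_prod[symmetric] by (rule measurable_fst)
  have X[measurable]: "X i \<in> borel_measurable M" if "i \<in> I" for i
    using measurable_compose[OF Z[OF that] fst_b] by simp
  have Xr[measurable]: "(\<lambda>w. \<lambda>j\<in>I. X j w) \<in> measurable M (Pi\<^sub>M I (\<lambda>_. borel))"
    by measurable
  have eZ[measurable]: "(\<lambda>w. e (X i w, Y i w)) \<in> borel_measurable M" if "i \<in> I" for i
    using measurable_compose[OF Z[OF that] e] .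
  have Wm[measurable]: "Measurable.pred M (\<lambda>w. W i (\<lambda>j\<in>I. X j w))" if "i \<in> I" for i
    using that by measurable
  have S_sub: "S w \<subseteq> I" for w by (auto simp: S)
  \<comment> \<open>Writing sums over the random set as sums over the fixed \<open>I\<close> makes
    measurability visible.\<close>
  have card_S: "real (card (S w)) = (\<Sum>i\<in>I. if W i (\<lambda>j\<in>I. X j w) then 1 else 0)" for w
    using I(1) by (simp add: S sum.If_cases Int_def)
  have sum_S: "(\<Sum>i\<in>S w. e (X i w, Y i w)) = (\<Sum>i\<in>I. if W i (\<lambda>j\<in>I. X j w) then e (X i w, Y i w) else 0)" for w
    using I(1) by (simp add: S sum.If_cases Int_def)
  have card_meas[measurable]: "(\<lambda>w. real (card (S w))) \<in> borel_measurable M"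
    unfolding card_S by measurable
  have sum_meas[measurable]: "(\<lambda>w. \<Sum>i\<in>S w. e (X i w, Y i w)) \<in> borel_measurable M"
    unfolding sum_S by measurable
  have "?E = {w \<in> space M. real m \<le> real (card (S w)) \<and> s * real (card (S w)) < (\<Sum>i\<in>S w. e (X i w, Y i w))}"
    by simp
  also have "\<dots> \<in> sets M" by measurable
  finally show E_meas: "?E \<in> sets M" .
  \<comment> \<open>The maximizer of \<open>l * s - l\<^sup>2 * v / 2\<close>, with value
    \<open>s\<^sup>2 / (2 * v)\<close>; it does not depend on the size of the index set.\<close>
  define l where "l = s / v"
  define G where "G z = ennreal (exp (l * e z - l\<^sup>2 * v / 2))" for z
  have [measurable]: "G \<in> borel_measurable borel" unfolding G_def by measurable
  \<comment> \<open>Unselected indices contribute the factor \<open>1\<close>, which turns a product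
    over the random set into one over \<open>I\<close>.\<close>
  define H where "H w = (\<Prod>i\<in>I. if W i (\<lambda>j\<in>I. X j w) then G (X i w, Y i w) else 1)" for w
  have [measurable]: "H \<in> borel_measurable M"
    unfolding H_def G_def by measurable
  have H_int: "(\<integral>\<^sup>+w. H w \<partial>M) \<le> 1"
  proof -
    let ?Z = "\<lambda>w. \<lambda>i\<in>I. (X i w, Y i w)"
    let ?P = "\<lambda>z. \<Prod>i\<in>I. if W i (\<lambda>j\<in>I. fst (z j)) then G (z i) else 1"
    have [measurable]: "?Z \<in> measurable M (Pi\<^sub>M I (\<lambda>_. borel))" by measurable
    have [measurable]: "?P \<in> borel_measurable (Pi\<^sub>M I (\<lambda>_. borel))"
      by (intro borel_measurable_prod_ennreal) measurable
    have "(\<integral>\<^sup>+w. H w \<partial>M) = (\<integral>\<^sup>+w. ?P (?Z w) \<partial>M)"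
    proof (intro nn_integral_cong)
      fix w
      have "(\<lambda>j\<in>I. fst (?Z w j)) = (\<lambda>j\<in>I. X j w)" by (auto simp: fun_eq_iff)
      then show "H w = ?P (?Z w)" unfolding H_def by (intro prod.cong) auto
    qed
    also have "\<dots> = (\<integral>\<^sup>+z. ?P z \<partial>distr M (Pi\<^sub>M I (\<lambda>_. borel)) ?Z)"
      by (rule nn_integral_distr[symmetric]) measurable
    also have "distr M (Pi\<^sub>M I (\<lambda>_. borel)) ?Z = Pi\<^sub>M I (\<lambda>i. distr M borel (\<lambda>w. (X i w, Y i w)))"
      by (rule indep_vars_iff_distr_eq_PiM'[THEN iffD1, OF I(2) Z indep])
    also have "\<dots> = Pi\<^sub>M I (\<lambda>_. \<mu>)" by (intro PiM_cong distr refl)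
    also have "(\<integral>\<^sup>+z. ?P z \<partial>Pi\<^sub>M I (\<lambda>_. \<mu>)) \<le> 1"
      by (rule nn_integral_PiM_selected_prod_le_1[OF \<mu> _ _ I(1) order.refl W])
        (auto simp: G_def intro: mgf)
    finally show ?thesis .
  qed
  let ?c = "ennreal (exp (- (real m * s\<^sup>2 / (2 * v))))"
  have "?E \<subseteq> {w \<in> space M. 1 \<le> ?c * H w}"
  proof safe
    fix w assume w: "w \<in> space M" "m \<le> card (S w)" "s * card (S w) < (\<Sum>i\<in>S w. e (X i w, Y i w))"
    let ?N = "real (card (S w))"
    have "H w = (\<Prod>i\<in>S w. G (X i w, Y i w))"
      unfolding H_def S using I(1) by (simp add: prod.If_cases Int_def)
    also have "\<dots> = ennreal (exp (\<Sum>i\<in>S w. (l * e (X i w, Y i w) - l\<^sup>2 * v / 2)))"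
      unfolding G_def using finite_subset[OF S_sub I(1)] by (simp add: prod_ennreal exp_sum)
    also have "(\<Sum>i\<in>S w. (l * e (X i w, Y i w) - l\<^sup>2 * v / 2))
        = l * (\<Sum>i\<in>S w. e (X i w, Y i w)) - ?N * (l\<^sup>2 * v / 2)"
      by (simp add: sum_subtractf sum_distrib_left)
    finally have H: "H w = ennreal (exp (l * (\<Sum>i\<in>S w. e (X i w, Y i w)) - ?N * (l\<^sup>2 * v / 2)))" .
    have "real m * s\<^sup>2 / (2 * v) \<le> ?N * s\<^sup>2 / (2 * v)"
      using w(2) v by (intro divide_right_mono mult_right_mono) auto
    also have "\<dots> = l * (s * ?N) - ?N * (l\<^sup>2 * v / 2)"
      using v by (simp add: l_def field_simps power2_eq_square)
    also have "\<dots> \<le> l * (\<Sum>i\<in>S w. e (X i w, Y i w)) - ?N * (l\<^sup>2 * v / 2)"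
      using w(3) v s by (intro diff_right_mono mult_left_mono) (auto simp: l_def)
    finally have "exp 0 \<le> exp (- (real m * s\<^sup>2 / (2 * v))
        + (l * (\<Sum>i\<in>S w. e (X i w, Y i w)) - ?N * (l\<^sup>2 * v / 2)))"
      by simp
    then have "ennreal 1 \<le> ennreal (exp (- (real m * s\<^sup>2 / (2 * v)))
        * exp (l * (\<Sum>i\<in>S w. e (X i w, Y i w)) - ?N * (l\<^sup>2 * v / 2)))"
      by (intro ennreal_leI) (simp only: exp_add exp_zero)
    then show "1 \<le> ?c * H w" unfolding H by (simp add: ennreal_mult)
  qed
  then have "emeasure M ?E \<le> emeasure M {w \<in> space M. 1 \<le> ?c * H w}"
    by (intro emeasure_mono) measurable
  also have "\<dots> \<le> ?c * (\<integral>\<^sup>+w. H w * indicator (space M) w \<partial>M)"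
    by (rule nn_integral_Markov_inequality) measurable
  also have "(\<integral>\<^sup>+w. H w * indicator (space M) w \<partial>M) = (\<integral>\<^sup>+w. H w \<partial>M)"
    by (intro nn_integral_cong) simp
  also have "?c * (\<integral>\<^sup>+w. H w \<partial>M) \<le> ?c * 1"
    by (intro mult_left_mono H_int) simp
  finally show "emeasure M ?E \<le> ?c" by simp
qed

lemma measurable_vec_nth[measurable]: "(\<lambda>x :: real ^ 'd. x $ k) \<in> borel_measurable borel"
  by (intro borel_measurable_continuous_onI continuous_intros)

text \<open>The threshold \<open>s\<close> solves \<open>m * s\<^sup>2 / (2 * v) = u\<close>. An
  exceptional set \<open>B\<close> is asserted so that for \<open>v = 0\<close> a null set
  containing all nonzero noise can be supplied.\<close>

lemma (in prob_space) spanned_sum_tail: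
  fixes X :: "nat \<Rightarrow> 'a \<Rightarrow> real ^ 'd" and Y :: "nat \<Rightarrow> 'a \<Rightarrow> real"
    and e :: "(real ^ 'd) \<times> real \<Rightarrow> real" and v :: real
  assumes n: "0 < n" and p: "\<And>k. p k \<in> {1..n}" and q: "\<And>k. q k \<in> {1..n}"
    and indep: "indep_vars (\<lambda>_. borel) (\<lambda>i w. (X i w, Y i w)) {1..n}"
    and distr: "\<And>i. i \<in> {1..n} \<Longrightarrow> distr M borel (\<lambda>w. (X i w, Y i w)) = \<mu>"
    and e: "e \<in> borel_measurable borel"
    and mgf: "\<And>\<psi> t. \<psi> \<in> borel_measurable borel \<Longrightarrow>
      (\<integral>\<^sup>+z. \<psi> (fst z) * ennreal (exp (t * e z - t\<^sup>2 * v / 2)) \<partial>\<mu>) \<le> (\<integral>\<^sup>+z. \<psi> (fst z) \<partial>\<mu>)"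
    and v: "0 \<le> v" and m: "0 < m" and u: "0 \<le> u"
  shows "\<exists>B\<in>events. prob B \<le> exp (- u) \<and> (\<forall>w\<in>space M - B. m \<le> card (spanned n p q (\<lambda>i. X i w)) \<longrightarrow>
    (\<Sum>i\<in>spanned n p q (\<lambda>i. X i w). e (X i w, Y i w))
      \<le> sqrt (2 * v * u / m) * card (spanned n p q (\<lambda>i. X i w)))"
proof -
  have ne: "{1..n} \<noteq> {}" using n by simp
  have Z[measurable]: "(\<lambda>w. (X i w, Y i w)) \<in> borel_measurable M" if "i \<in> {1..n}" for i
    using indep that by (auto simp: indep_vars_def)
  show ?thesis
  proof (cases "v = 0")
    case False
    let ?s = "sqrt (2 * v * u / m)"
    let ?W = "\<lambda>i (x :: nat \<Rightarrow> real ^ 'd). \<forall>k. x (p k) $ k \<le> x i $ k \<and> x i $ k \<le> x (q k) $ k"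
    let ?S = "\<lambda>w. spanned n p q (\<lambda>i. X i w)"
    let ?B = "{w \<in> space M. m \<le> card (?S w) \<and> ?s * card (?S w) < (\<Sum>i\<in>?S w. e (X i w, Y i w))}"
    have W: "Measurable.pred (Pi\<^sub>M {1..n} (\<lambda>_. borel)) (?W i)" if i: "i \<in> {1..n}" for i
    proof -
      have c: "(\<lambda>x. x j $ k) \<in> borel_measurable (Pi\<^sub>M {1..n} (\<lambda>_. borel :: (real ^ 'd) measure))"
        if "j \<in> {1..n}" for j k
        by (rule measurable_compose[OF measurable_component_singleton[OF that] measurable_vec_nth])
      have le: "Measurable.pred (Pi\<^sub>M {1..n} (\<lambda>_. borel :: (real ^ 'd) measure)) (\<lambda>x. x j $ k \<le> x i $ k)"
        if "j \<in> {1..n}" "i \<in> {1..n}" for i j k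
        using borel_measurable_le[OF c[OF that(1)] c[OF that(2)]] by (simp add: pred_def)
      show ?thesis by (intro pred_intros_countable pred_intros_logic le i p q)
    qed
    \<comment> \<open>Because \<open>p k\<close> and \<open>q k\<close> lie in
      \<open>{1..n}\<close>, restricting the sample to these indices changes none of the compared
      values.\<close>
    have S: "?S w = {i \<in> {1..n}. ?W i (\<lambda>j\<in>{1..n}. X j w)}" for w
      using p q by (auto simp: spanned_def)
    have v0: "0 < v" using False v by simp
    have s0: "0 \<le> ?s" using v u by simp
    have "?B \<in> events" "emeasure M ?B \<le> ennreal (exp (- (real m * ?s\<^sup>2 / (2 * v))))"
      by (rule selected_sum_tail[OF _ ne indep distr e mgf W v0 s0 S]; simp)+
    moreover have "real m * ?s\<^sup>2 / (2 * v) = u" using v0 u m by simp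
    ultimately have "?B \<in> events" "prob ?B \<le> exp (- u)" by (simp_all add: emeasure_eq_measure)
    then show ?thesis by (intro bexI[of _ ?B]) (auto simp: not_less)
  next
    case True
    have \<mu>: "prob_space \<mu>" "sets \<mu> = sets borel"
      unfolding distr[of 1, symmetric, OF atLeastAtMost_iff[THEN iffD2]] using n
      by (auto intro!: prob_space_distr Z simp flip: distr[of 1])
    have "AE z in \<mu>. e z = 0"
    proof (rule AE_eq_0_of_degenerate_mgf[OF \<mu>(1)])
      show "e \<in> borel_measurable \<mu>" using e by (simp cong: measurable_cong_sets add: \<mu>(2))
      show "(\<integral>\<^sup>+z. ennreal (exp (t * e z)) \<partial>\<mu>) \<le> 1" for t
        using mgf[of "\<lambda>_. 1" t] True prob_space.emeasure_space_1[OF \<mu>(1)] by simp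
    qed
    then have AE0: "AE w in M. e (X i w, Y i w) = 0" if i: "i \<in> {1..n}" for i
      unfolding distr[OF i, symmetric] using e by (subst (asm) AE_distr_iff) (auto intro: Z i)
    have "AE w in M. \<forall>i\<in>{1..n}. e (X i w, Y i w) = 0"
      by (rule AE_finite_allI) (auto intro: AE0)
    then obtain B where B: "{w \<in> space M. \<not> (\<forall>i\<in>{1..n}. e (X i w, Y i w) = 0)} \<subseteq> B"
      "emeasure M B = 0" "B \<in> events"
      by (rule AE_E)
    have "prob B \<le> exp (- u)" using B(2) by (simp add: measure_def)
    moreover have "(\<Sum>i\<in>spanned n p q (\<lambda>i. X i w). e (X i w, Y i w)) = 0" if "w \<in> space M - B" for w
    proof -
      have "\<forall>i\<in>{1..n}. e (X i w, Y i w) = 0" using that B(1) by blast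
      then show ?thesis by (intro sum.neutral) (simp add: spanned_def)
    qed
    ultimately show ?thesis using B(3) True by (intro bexI[of _ B]) auto
  qed
qed

subsection \<open>Deviation of the sample\<close>

text \<open>Markov's inequality for \<open>(1 / 2) ^ N\<close>. Each factor has mean at most
  \<open>1 - p / 2 \<le> exp (- p / 2)\<close>, so the product has mean at most
  \<open>exp (- 2 * m)\<close>, and the threshold costs only the factor
  \<open>2 ^ (2 * m)\<close>.\<close>

lemma (in prob_space) count_lower_tail:
  fixes Z :: "nat \<Rightarrow> 'a \<Rightarrow> 'b::topological_space"
  assumes indep: "indep_vars (\<lambda>_. borel) Z {1..n}" and A[measurable]: "A \<in> sets borel"
    and p: "\<And>i. i \<in> {1..n} \<Longrightarrow> prob (Z i -` A \<inter> space M) \<ge> p"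
    and np: "4 * real m \<le> real n * p"
  shows "{w \<in> space M. num_points n (\<lambda>i. Z i w) A \<le> 2 * m} \<in> sets M"
    "emeasure M {w \<in> space M. num_points n (\<lambda>i. Z i w) A \<le> 2 * m} \<le> ennreal (exp (- real m / 4))"
proof -
  have Z[measurable]: "Z i \<in> borel_measurable M" if "i \<in> {1..n}" for i
    using indep that by (auto simp: indep_vars_def)
  have ind[measurable]: "(\<lambda>w. indicator A (Z i w) :: real) \<in> borel_measurable M"
      "(\<lambda>w. indicator A (Z i w) :: nat) \<in> measurable M (count_space UNIV)" if "i \<in> {1..n}" for i
    using Z[OF that] unfolding indicator_def by measurable
  define N where "N w = num_points n (\<lambda>i. Z i w) A" for w
  have [measurable]: "N \<in> measurable M (count_space UNIV)"
    unfolding N_def num_points_def by measurable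
  show "{w \<in> space M. num_points n (\<lambda>i. Z i w) A \<le> 2 * m} \<in> sets M"
    unfolding N_def[symmetric] by measurable
  define h :: "'b \<Rightarrow> ennreal" where "h z = ennreal (1 - indicator A z / 2)" for z
  have [measurable]: "h \<in> borel_measurable borel" unfolding h_def by measurable
  have h_indep: "indep_vars (\<lambda>_. borel) (\<lambda>i w. h (Z i w)) {1..n}"
    by (rule indep_vars_compose2[OF indep]) measurable
  have h_prod: "(\<Prod>i\<in>{1..n}. h (Z i w)) = ennreal ((1 / 2) ^ N w)" for w
  proof -
    have "(\<Prod>i\<in>{1..n}. h (Z i w)) = ennreal (\<Prod>i\<in>{1..n}. (1 / 2) ^ indicator A (Z i w))"
      unfolding h_def by (subst prod_ennreal[symmetric])
        (auto simp: indicator_def intro!: prod.cong)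
    then show ?thesis unfolding N_def num_points_def by (simp add: power_sum)
  qed
  have h_int: "(\<integral>\<^sup>+w. h (Z i w) \<partial>M) \<le> ennreal (exp (- p / 2))" if i: "i \<in> {1..n}" for i
  proof -
    define q where "q = prob (Z i -` A \<inter> space M)"
    have [measurable]: "Z i \<in> borel_measurable M" using i by (rule Z)
    have int: "integrable M (\<lambda>w. indicator (Z i -` A \<inter> space M) w :: real)"
      by (intro integrable_real_indicator) (auto simp: less_top[symmetric])
    have "(\<integral>\<^sup>+w. h (Z i w) \<partial>M) = (\<integral>\<^sup>+w. ennreal (1 - indicator (Z i -` A \<inter> space M) w / 2) \<partial>M)"
      by (intro nn_integral_cong) (auto simp: h_def indicator_def)
    also have "\<dots> = ennreal (\<integral>w. 1 - indicator (Z i -` A \<inter> space M) w / 2 \<partial>M)"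
      by (intro nn_integral_eq_integral Bochner_Integration.integrable_diff integrable_const
          integrable_divide int) (auto simp: indicator_def)
    also have "(\<integral>w. 1 - indicator (Z i -` A \<inter> space M) w / 2 \<partial>M) = 1 - q / 2"
      unfolding q_def using int by (subst Bochner_Integration.integral_diff) (auto simp: prob_space)
    also have "1 - q / 2 \<le> exp (- p / 2)"
      using exp_ge_add_one_self[of "- p / 2"] p[OF i] by (simp add: q_def)
    finally show ?thesis by (simp add: ennreal_leI)
  qed
  have "(\<integral>\<^sup>+w. ennreal ((1 / 2) ^ N w) \<partial>M) = (\<Prod>i\<in>{1..n}. \<integral>\<^sup>+w. h (Z i w) \<partial>M)"
    unfolding h_prod[symmetric]
    by (rule indep_vars_nn_integral[OF _ h_indep]) auto
  also have "\<dots> \<le> (\<Prod>i\<in>{1..n}. ennreal (exp (- p / 2)))" by (intro prod_mono_ennreal h_int)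
  also have "\<dots> = ennreal (exp (- (real n * p / 2)))"
    by (simp add: ennreal_power exp_of_nat_mult[symmetric])
  also have "\<dots> \<le> ennreal (exp (- 2 * real m))" using np by (intro ennreal_leI) simp
  finally have mgf: "(\<integral>\<^sup>+w. ennreal ((1 / 2) ^ N w) \<partial>M) \<le> ennreal (exp (- 2 * real m))" .
  have "emeasure M {w \<in> space M. N w \<le> 2 * m}
      \<le> emeasure M {w \<in> space M. 1 \<le> ennreal (2 ^ (2 * m)) * ennreal ((1 / 2) ^ N w)}"
  proof (intro emeasure_mono subsetI)
    fix w assume w: "w \<in> {w \<in> space M. N w \<le> 2 * m}"
    then have "(2::real) ^ N w \<le> 2 ^ (2 * m)" by (intro power_increasing) auto
    then have "1 \<le> (2::real) ^ (2 * m) * (1 / 2) ^ N w" by (simp add: power_one_over field_simps)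
    then have "ennreal 1 \<le> ennreal (2 ^ (2 * m) * (1 / 2) ^ N w)" by (rule ennreal_leI)
    then show "w \<in> {w \<in> space M. 1 \<le> ennreal (2 ^ (2 * m)) * ennreal ((1 / 2) ^ N w)}"
      using w by (simp add: ennreal_mult)
  qed measurable
  also have "\<dots> \<le> ennreal (2 ^ (2 * m)) * (\<integral>\<^sup>+w. ennreal ((1 / 2) ^ N w) \<partial>M)"
  proof -
    have "(\<integral>\<^sup>+w. ennreal ((1 / 2) ^ N w) * indicator (space M) w \<partial>M) = (\<integral>\<^sup>+w. ennreal ((1 / 2) ^ N w) \<partial>M)"
      by (intro nn_integral_cong) simp
    then show ?thesis
      using nn_integral_Markov_inequality[of "\<lambda>w. ennreal ((1 / 2) ^ N w)" "space M" M "ennreal (2 ^ (2 * m))"]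
      by simp
  qed
  also have "\<dots> \<le> ennreal (2 ^ (2 * m)) * ennreal (exp (- 2 * real m))"
    using mgf by (rule mult_left_mono) simp
  also have "\<dots> = ennreal (exp (2 * real m * ln 2 - 2 * real m))"
  proof -
    have "(2::real) ^ (2 * m) = exp (real (2 * m) * ln 2)"
      by (subst exp_of_nat_mult) simp
    then show ?thesis by (simp add: ennreal_mult[symmetric] exp_add[symmetric])
  qed
  also have "\<dots> \<le> ennreal (exp (- real m / 4))"
  proof -
    \<comment> \<open>The resulting exponent per unit of \<open>m\<close> is at most
      \<open>2 * (25 / 36) - 2 = - 11 / 18\<close>, which is below \<open>- 1 / 4\<close>.\<close>
    have "real m * ln 2 \<le> real m * (25 / 36)" by (intro mult_left_mono ln2_le_25_over_36) simp
    then show ?thesis by (intro ennreal_leI) simp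
  qed
  finally show "emeasure M {w \<in> space M. num_points n (\<lambda>i. Z i w) A \<le> 2 * m}
      \<le> ennreal (exp (- real m / 4))"
    by (simp add: N_def)
qed

section \<open>Absence of ties and auxiliary probability bounds\<close>

text \<open>By Fubini, the measure of the diagonal is the integral over \<open>c\<close> of the mass
  that the law of \<open>V\<close> gives to \<open>{c}\<close>, and \<open>V\<close> has no
  atoms.\<close>

lemma (in prob_space) AE_neq_of_indep:
  fixes U V :: "'a \<Rightarrow> real"
  assumes indep: "indep_var borel U borel V" and V: "\<And>c. emeasure M (V -` {c} \<inter> space M) = 0"
  shows "AE w in M. U w \<noteq> V w"
proof -
  have rv[measurable]: "U \<in> borel_measurable M" "V \<in> borel_measurable M"
    and d: "distr M borel U \<Otimes>\<^sub>M distr M borel V = distr M (borel \<Otimes>\<^sub>M borel) (\<lambda>w. (U w, V w))"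
    using indep unfolding indep_var_distribution_eq by auto
  interpret V: prob_space "distr M borel V" by (rule prob_space_distr) measurable
  define D where "D = {z :: real \<times> real. fst z = snd z}"
  have D: "D \<in> sets (borel \<Otimes>\<^sub>M borel)"
    unfolding D_def borel_prod by (intro borel_closed closed_Collect_eq continuous_intros)
  have Dc: "Pair c -` D = {c}" for c by (auto simp: D_def)
  have "emeasure M {w \<in> space M. U w = V w} = emeasure M ((\<lambda>w. (U w, V w)) -` D \<inter> space M)"
    by (intro arg_cong[where f="emeasure M"]) (auto simp: D_def)
  also have "\<dots> = emeasure (distr M borel U \<Otimes>\<^sub>M distr M borel V) D"
    unfolding d by (rule emeasure_distr[symmetric]) (use D in measurable)
  also have "\<dots> = (\<integral>\<^sup>+c. emeasure (distr M borel V) {c} \<partial>distr M borel U)"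
    using D by (subst V.emeasure_pair_measure_alt) (auto simp: Dc cong: sets_pair_measure_cong)
  also have "\<dots> = 0" using V by (simp add: emeasure_distr)
  finally have "emeasure M {w \<in> space M. U w = V w} = 0" .
  then show ?thesis
    by (intro AE_I[where N="{w \<in> space M. U w = V w}"]) auto
qed

text \<open>Hyperplanes are Lebesgue negligible and Borel. This later makes the coordinates of the
  covariates atomless.\<close>

lemma emeasure_lborel_hyperplane: "emeasure lborel {x :: real ^ 'd. x $ k = c} = 0"
proof -
  have "{x :: real ^ 'd. x $ k = c} = {x. axis k 1 \<bullet> x = c}"
    by (simp add: cart_eq_inner_axis inner_commute)
  moreover have "negligible {x :: real ^ 'd. axis k 1 \<bullet> x = c}"
    by (rule negligible_hyperplane) simp
  ultimately have "{x :: real ^ 'd. x $ k = c} \<in> null_sets lebesgue"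
    by (simp add: negligible_iff_null_sets)
  moreover have "{x :: real ^ 'd. x $ k = c} \<in> sets borel" by measurable
  ultimately show ?thesis by (simp add: null_sets_def)
qed

lemma (in prob_space) prob_ge_of_density_ge:
  fixes X :: "'a \<Rightarrow> real ^ 'd"
  assumes X: "distributed M lborel X (\<lambda>x. indicator unit_cube x * ennreal (f x))"
    and f: "\<forall>x\<in>unit_cube. c \<le> f x" and c: "0 \<le> c"
    and A[measurable]: "A \<in> sets borel" and sub: "A \<subseteq> unit_cube"
  shows "c * measure lborel A \<le> prob (X -` A \<inter> space M)"
proof -
  have "emeasure lborel A \<le> emeasure lborel (unit_cube :: (real ^ 'd) set)"
    by (rule emeasure_mono[OF sub]) simp
  also have "\<dots> < \<infinity>" by (rule emeasure_lborel_cbox_finite)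
  finally have fin: "emeasure lborel A = ennreal (measure lborel A)"
    by (simp add: emeasure_eq_ennreal_measure less_top)
  have "ennreal (c * measure lborel A) = (\<integral>\<^sup>+x. ennreal c * indicator A x \<partial>lborel)"
    using c fin by (simp add: nn_integral_cmult_indicator ennreal_mult)
  also have "\<dots> \<le> (\<integral>\<^sup>+x. indicator unit_cube x * ennreal (f x) * indicator A x \<partial>lborel)"
    using f sub by (intro nn_integral_mono) (auto simp: indicator_def intro!: ennreal_leI)
  also have "\<dots> = emeasure M (X -` A \<inter> space M)"
    by (rule distributed_emeasure[OF X, symmetric]) simp
  finally show ?thesis by (simp add: emeasure_eq_measure)
qed

lemma (in prob_space) prob_union_bound:
  fixes K c :: real
  assumes F: "finite F" "card F \<le> K" and c: "0 \<le> c"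
    and B: "\<And>i. i \<in> F \<Longrightarrow> B i \<in> events" "\<And>i. i \<in> F \<Longrightarrow> prob (B i) \<le> c"
  shows "prob (\<Union>i\<in>F. B i) \<le> K * c"
proof -
  have "prob (\<Union>i\<in>F. B i) \<le> (\<Sum>i\<in>F. prob (B i))"
    using F(1) B(1) by (intro finite_measure_subadditive_finite) auto
  also have "\<dots> \<le> card F * c" using sum_bounded_above[of F "\<lambda>i. prob (B i)" c] B(2) by simp
  also have "\<dots> \<le> K * c" using F(2) c by (intro mult_right_mono) auto
  finally show ?thesis .
qed

text \<open>The pairs are those of a lower and an upper corner; extensional functions on
  \<open>UNIV\<close> are all functions.\<close>

lemma card_fun_pairs:
  "card (PiE (UNIV :: 'd::finite set) (\<lambda>_. A) \<times> PiE (UNIV :: 'd set) (\<lambda>_. A)) = card A ^ (2 * CARD('d))"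
  by (simp add: card_cartesian_product card_PiE mult_2 power_add)

lemma finite_fun_pairs:
  "finite A \<Longrightarrow> finite (PiE (UNIV :: 'd::finite set) (\<lambda>_. A) \<times> PiE (UNIV :: 'd set) (\<lambda>_. A))"
  by (intro finite_cartesian_product finite_PiE) auto

theorem theorem18:
  fixes M :: "'w measure"
    and X :: "nat \<Rightarrow> 'w \<Rightarrow> real ^ 'd"
    and Y :: "nat \<Rightarrow> 'w \<Rightarrow> real"
    and g :: "real ^ 'd \<Rightarrow> real"
    and f\<^sub>X :: "real ^ 'd \<Rightarrow> real"
    and b \<beta> \<delta> \<sigma> L :: real
    and n m :: nat
    and cl :: "'d tie_rule"
    and cost :: "(nat \<Rightarrow> (real ^ 'd) \<times> real) \<Rightarrow> 'd \<times> real \<Rightarrow> (real ^ 'd) set \<Rightarrow> real"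
  assumes "prob_space M"
    and "0 < \<delta>" and "\<delta> < 1 / 3"
    and "n \<ge> 1" and "\<beta> \<ge> 2" and "m \<in> {1..n}"
    and "real m \<ge> 4 * ln (4 * (2 * real n + 1) ^ (2 * CARD('d)) / \<delta>)"
    \<comment> \<open>index 0 is the generic pair (X, Y), the indices 1, ..., n are the sample\<close>
    and "prob_space.indep_vars M (\<lambda>_. borel) (\<lambda>i w. (X i w, Y i w)) {0..n}"
    and "\<forall>i\<in>{1..n}. distr M borel (\<lambda>w. (X i w, Y i w)) = distr M borel (\<lambda>w. (X 0 w, Y 0 w))"
    and "distributed M lborel (X 0) (\<lambda>x. indicator unit_cube x * ennreal (f\<^sub>X x))"
    and "b > 0" and "\<forall>x\<in>unit_cube. f\<^sub>X x \<ge> b"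
    and "regression_function M (X 0) (Y 0) g"
    and "cond_sub_gaussian M (X 0) (\<lambda>w. Y 0 w - g (X 0 w)) (\<sigma>\<^sup>2)"
    and "L-lipschitz_on unit_cube g"
  shows "\<exists>A\<in>sets M. measure M A \<ge> 1 - 3 * \<delta> \<and>
    (\<forall>w\<in>A. \<forall>P.
       cart_partition cl n (\<lambda>i. X i w) \<beta> m (cost (\<lambda>i\<in>{1..n}. (X i w, Y i w))) P \<longrightarrow>
       (\<forall>x\<in>unit_cube.
          \<bar>local_estimator n (\<lambda>i. X i w) (\<lambda>i. Y i w) P x - g x\<bar>
            \<le> sqrt (2 * \<sigma>\<^sup>2 * ln ((real n + 1) ^ (2 * CARD('d)) / \<delta>) / real m)
              + lip_const g (cell_of P x) * \<beta> * sqrt (real CARD('d))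
                * (5 * real m / (real n * b)) powr (1 / real CARD('d))))"
proof -
  interpret prob_space M by (rule assms(1))
  let ?d = "CARD('d)"
  note \<delta> = assms(2,3)
  have n: "0 < n" and m: "0 < m" "m \<le> n" and \<beta>: "1 \<le> \<beta>" using assms(4-6) by auto
  note indep0 = assms(8) and dens = assms(10) and b = assms(11) and f_ge = assms(12)
  note lip = assms(15)

  \<comment> \<open>Independence and common law of the sample\<close>
  have indep: "indep_vars (\<lambda>_. borel) (\<lambda>i w. (X i w, Y i w)) {1..n}"
    by (rule indep_vars_subset[OF indep0]) auto
  have Z[measurable]: "(\<lambda>w. (X i w, Y i w)) \<in> borel_measurable M" if "i \<in> {0..n}" for i
    using indep0 that by (auto simp: indep_vars_def)
  have fst_b: "(fst :: (real ^ 'd) \<times> real \<Rightarrow> real ^ 'd) \<in> borel_measurable borel"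
    and snd_b: "(snd :: (real ^ 'd) \<times> real \<Rightarrow> real) \<in> borel_measurable borel"
    unfolding borel_prod[symmetric] by (rule measurable_fst, rule measurable_snd)
  have X_meas: "X i \<in> borel_measurable M" and Y_meas: "Y i \<in> borel_measurable M" if "i \<in> {0..n}" for i
    using measurable_compose[OF Z[OF that] fst_b] measurable_compose[OF Z[OF that] snd_b] by simp_all
  have indepX: "indep_vars (\<lambda>_. borel) X {1..n}"
    using indep_vars_compose2[OF indep, of "\<lambda>_. fst" "\<lambda>_. borel"] fst_b by simp
  define \<mu> where "\<mu> = distr M borel (\<lambda>w. (X 0 w, Y 0 w))"
  have distr: "distr M borel (\<lambda>w. (X i w, Y i w)) = \<mu>" if "i \<in> {1..n}" for i
    using assms(9) that by (simp add: \<mu>_def)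
  have law: "emeasure M (X i -` A \<inter> space M) = emeasure M (X 0 -` A \<inter> space M)"
    if i: "i \<in> {1..n}" and A: "A \<in> sets borel" for i A
  proof -
    have "fst -` A \<in> sets (borel :: ((real ^ 'd) \<times> real) measure)"
      using measurable_sets[OF fst_b A] by simp
    then have "emeasure M ((\<lambda>w. (X j w, Y j w)) -` (fst -` A) \<inter> space M)
        = emeasure (distr M borel (\<lambda>w. (X j w, Y j w))) (fst -` A)" if "j \<in> {0..n}" for j
      using Z[OF that] by (simp add: emeasure_distr)
    from this[of i] this[of 0] show ?thesis
      using i distr[OF i] by (simp add: \<mu>_def vimage_def)
  qed

  \<comment> \<open>Exponential moments of the noise\<close>
  have g: "g \<in> borel_measurable borel" using assms(13) by (simp add: regression_function_def)
  define e where "e z = snd z - g (fst z)" for z :: "(real ^ 'd) \<times> real"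
  have e: "e \<in> borel_measurable borel"
    unfolding e_def by (intro borel_measurable_diff snd_b measurable_compose[OF fst_b g])
  have mgf: "(\<integral>\<^sup>+z. \<psi> (fst z) * ennreal (exp (t * e z - t\<^sup>2 * \<sigma>\<^sup>2 / 2)) \<partial>\<mu>) \<le> (\<integral>\<^sup>+z. \<psi> (fst z) \<partial>\<mu>)"
    if \<psi>: "\<psi> \<in> borel_measurable borel" for \<psi> t
  proof -
    have \<psi>': "(\<lambda>z. \<psi> (fst z)) \<in> borel_measurable (borel :: ((real ^ 'd) \<times> real) measure)"
      by (rule measurable_compose[OF fst_b \<psi>])
    have em: "(\<lambda>w. Y 0 w - g (X 0 w)) \<in> borel_measurable M"
      using X_meas[of 0] Y_meas[of 0] by (intro borel_measurable_diff measurable_compose[OF _ g]) auto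
    have "(\<lambda>z. \<psi> (fst z) * ennreal (exp (t * e z - t\<^sup>2 * \<sigma>\<^sup>2 / 2))) \<in> borel_measurable borel"
      using \<psi>' e by measurable
    then have "(\<integral>\<^sup>+z. \<psi> (fst z) * ennreal (exp (t * e z - t\<^sup>2 * \<sigma>\<^sup>2 / 2)) \<partial>\<mu>)
        = (\<integral>\<^sup>+w. \<psi> (X 0 w) * ennreal (exp (t * (Y 0 w - g (X 0 w)) - t\<^sup>2 * \<sigma>\<^sup>2 / 2)) \<partial>M)"
      unfolding \<mu>_def by (subst nn_integral_distr) (auto simp: e_def intro: Z)
    also have "\<dots> \<le> (\<integral>\<^sup>+w. \<psi> (X 0 w) \<partial>M)"
      by (rule cond_mgf_bound[OF assms(1) X_meas em assms(14) \<psi>]) simp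
    also have "\<dots> = (\<integral>\<^sup>+z. \<psi> (fst z) \<partial>\<mu>)"
      unfolding \<mu>_def using \<psi>' by (subst nn_integral_distr) (auto intro: Z)
    finally show ?thesis .
  qed
  \<comment> \<open>Replacing \<open>t\<close> by \<open>- t\<close> handles the negated noise,
    hence deviations to the other side.\<close>
  have mgf': "(\<integral>\<^sup>+z. \<psi> (fst z) * ennreal (exp (t * (- e z) - t\<^sup>2 * \<sigma>\<^sup>2 / 2)) \<partial>\<mu>) \<le> (\<integral>\<^sup>+z. \<psi> (fst z) \<partial>\<mu>)"
    if "\<psi> \<in> borel_measurable borel" for \<psi> t
    using mgf[OF that, of "- t"] by simp

  \<comment> \<open>Consequences of the density bound and of the size of \<open>m\<close>\<close>
  \<comment> \<open>A density of at least \<open>b\<close> on a cube of volume \<open>1\<close> has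
    mass at least \<open>b\<close>.\<close>
  have b1: "b \<le> 1"
  proof -
    have "b * 1 \<le> prob (X 0 -` unit_cube \<inter> space M)"
      using prob_ge_of_density_ge[OF dens f_ge, of unit_cube] b
      by (simp add: content_cbox_cart interval_ne_empty_cart)
    also have "\<dots> \<le> 1" by (rule prob_le_1)
    finally show ?thesis by simp
  qed
  have prob_ge: "b * measure lborel A \<le> prob (X i -` A \<inter> space M)"
    if "i \<in> {1..n}" "A \<in> sets borel" "A \<subseteq> unit_cube" for i A
    using prob_ge_of_density_ge[OF dens f_ge _ that(2,3)] b law[OF that(1,2)] by (simp add: measure_def)
  \<comment> \<open>As \<open>1 \<le> ln 3 \<le> ln (2 * n + 1)\<close>, the assumed lower bound on
    \<open>m\<close> is at least \<open>8 * d\<close>. So \<open>m\<close> can absorb the trimming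
    loss.\<close>
  have dm: "?d \<le> m"
  proof -
    have "1 \<le> ln (3 :: real)" using exp_le by (subst ln_ge_iff) auto
    also have "ln (3 :: real) \<le> ln (2 * real n + 1)" using n by simp
    finally have "real (2 * ?d) * 1 \<le> real (2 * ?d) * ln (2 * real n + 1)"
      by (intro mult_left_mono) auto
    also have "\<dots> = ln ((2 * real n + 1) ^ (2 * ?d))" using n by (simp add: ln_realpow)
    also have "\<dots> \<le> ln (4 * (2 * real n + 1) ^ (2 * ?d) / \<delta>)"
    proof -
      have "(2 * real n + 1) ^ (2 * ?d) * \<delta> \<le> (2 * real n + 1) ^ (2 * ?d) * 4"
        using \<delta> by (intro mult_left_mono) auto
      then show ?thesis using \<delta> n by (subst ln_le_cancel_iff) (auto simp: field_simps)
    qed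
    finally show ?thesis using assms(7) by linarith
  qed

  \<comment> \<open>Uniform control of the noise\<close>
  define u where "u = ln ((real n + 1) ^ (2 * ?d) / \<delta>)"
  have K1: "1 \<le> (real n + 1) ^ (2 * ?d)" by (rule one_le_power) simp
  have u: "0 \<le> u"
  proof -
    have "\<delta> \<le> (real n + 1) ^ (2 * ?d)" using K1 \<delta> by linarith
    then show ?thesis unfolding u_def using \<delta> by (intro ln_ge_zero) (simp add: le_divide_eq_1_pos)
  qed
  \<comment> \<open>\<open>u\<close> is chosen so that \<open>(n + 1) ^ (2 * d)\<close> events of
    this probability add up to \<open>\<delta>\<close>.\<close>
  have exp_u: "exp (- u) = \<delta> / (real n + 1) ^ (2 * ?d)"
    unfolding u_def using K1 \<delta> by (simp add: exp_minus)
  define s where "s = sqrt (2 * \<sigma>\<^sup>2 * u / m)"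
  define FT where "FT = PiE (UNIV :: 'd set) (\<lambda>_. {1..n}) \<times> PiE (UNIV :: 'd set) (\<lambda>_. {1..n})"
  have FT: "finite FT" "real (card FT) \<le> (real n + 1) ^ (2 * ?d)"
    unfolding FT_def card_fun_pairs by (auto intro!: finite_fun_pairs power_mono)

  let ?S = "\<lambda>t w. spanned n (fst t) (snd t) (\<lambda>i. X i w)"
  have "\<exists>B\<in>events. prob B \<le> exp (- u) \<and> (\<forall>w\<in>space M - B. m \<le> card (?S t w) \<longrightarrow>
      (\<Sum>i\<in>?S t w. e (X i w, Y i w)) \<le> s * card (?S t w))" if "t \<in> FT" for t
    unfolding s_def
    by (rule spanned_sum_tail[OF n _ _ indep distr e mgf _ m(1) u]) (use that in \<open>auto simp: FT_def\<close>)
  then have "\<forall>t\<in>FT. \<exists>B. B \<in> events \<and> prob B \<le> exp (- u) \<and> (\<forall>w\<in>space M - B. m \<le> card (?S t w) \<longrightarrow>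
      (\<Sum>i\<in>?S t w. e (X i w, Y i w)) \<le> s * card (?S t w))" by blast
  then obtain B1 where B1: "\<forall>t\<in>FT. B1 t \<in> events \<and> prob (B1 t) \<le> exp (- u) \<and>
      (\<forall>w\<in>space M - B1 t. m \<le> card (?S t w) \<longrightarrow> (\<Sum>i\<in>?S t w. e (X i w, Y i w)) \<le> s * card (?S t w))"
    by (rule bchoice[THEN exE])
  have "\<exists>B\<in>events. prob B \<le> exp (- u) \<and> (\<forall>w\<in>space M - B. m \<le> card (?S t w) \<longrightarrow>
      (\<Sum>i\<in>?S t w. - e (X i w, Y i w)) \<le> s * card (?S t w))" if "t \<in> FT" for t
    unfolding s_def
    by (rule spanned_sum_tail[OF n _ _ indep distr borel_measurable_uminus[OF e] mgf' _ m(1) u])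
      (use that in \<open>auto simp: FT_def\<close>)
  then have "\<forall>t\<in>FT. \<exists>B. B \<in> events \<and> prob B \<le> exp (- u) \<and> (\<forall>w\<in>space M - B. m \<le> card (?S t w) \<longrightarrow>
      (\<Sum>i\<in>?S t w. - e (X i w, Y i w)) \<le> s * card (?S t w))" by blast
  then obtain B2 where B2: "\<forall>t\<in>FT. B2 t \<in> events \<and> prob (B2 t) \<le> exp (- u) \<and>
      (\<forall>w\<in>space M - B2 t. m \<le> card (?S t w) \<longrightarrow> (\<Sum>i\<in>?S t w. - e (X i w, Y i w)) \<le> s * card (?S t w))"
    by (rule bchoice[THEN exE])
  \<comment> \<open>One family of events for each sign of the noise, hence a total of
    \<open>2 * \<delta>\<close>.\<close>
  define B12 where "B12 = (\<Union>t\<in>FT. B1 t) \<union> (\<Union>t\<in>FT. B2 t)"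
  have "prob (\<Union>t\<in>FT. B1 t) \<le> (real n + 1) ^ (2 * ?d) * exp (- u)"
    by (rule prob_union_bound[OF FT]) (use B1 in auto)
  moreover have "prob (\<Union>t\<in>FT. B2 t) \<le> (real n + 1) ^ (2 * ?d) * exp (- u)"
    by (rule prob_union_bound[OF FT]) (use B2 in auto)
  moreover have "(real n + 1) ^ (2 * ?d) * exp (- u) = \<delta>" using K1 by (simp add: exp_u)
  moreover have ev1: "(\<Union>t\<in>FT. B1 t) \<in> events" "(\<Union>t\<in>FT. B2 t) \<in> events"
    using B1 B2 FT(1) by auto
  ultimately have B12: "B12 \<in> events" "prob B12 \<le> 2 * \<delta>"
    using measure_Un_le[OF ev1] by (auto simp: B12_def)

  \<comment> \<open>Uniform lower bounds on the counts in grid boxes\<close>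
  \<comment> \<open>The volume condition gives these boxes probability at least
    \<open>4 * m / n\<close>, as the lower tail bound requires. The family is not random, so a union
    bound applies.\<close>
  define FG where "FG = {t \<in> PiE (UNIV :: 'd set) (\<lambda>_. {0..2 * n}) \<times> PiE (UNIV :: 'd set) (\<lambda>_. {0..2 * n}).
    grid_box n (fst t) (snd t) \<subseteq> unit_cube \<and>
    4 * real m \<le> real n * (b * measure lborel (grid_box n (fst t) (snd t)))}"
  have FG: "finite FG" "real (card FG) \<le> (2 * real n + 1) ^ (2 * ?d)"
  proof -
    let ?Q = "PiE (UNIV :: 'd set) (\<lambda>_. {0..2 * n}) \<times> PiE (UNIV :: 'd set) (\<lambda>_. {0..2 * n})"
    have Q: "finite ?Q" by (rule finite_fun_pairs) simp
    then show "finite FG" by (rule rev_finite_subset) (auto simp: FG_def)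
    have "card FG \<le> card ?Q" using Q by (rule card_mono) (auto simp: FG_def)
    then have "card FG \<le> (2 * n + 1) ^ (2 * ?d)" by (simp add: card_fun_pairs)
    then have "real (card FG) \<le> real ((2 * n + 1) ^ (2 * ?d))" by (rule of_nat_mono)
    then show "real (card FG) \<le> (2 * real n + 1) ^ (2 * ?d)" by (simp add: add.commute)
  qed
  define G where "G t = {w \<in> space M. num_points n (\<lambda>i. X i w) (grid_box n (fst t) (snd t)) \<le> 2 * m}"
    for t :: "('d \<Rightarrow> nat) \<times> ('d \<Rightarrow> nat)"
  have G: "G t \<in> events" "prob (G t) \<le> exp (- real m / 4)" if t: "t \<in> FG" for t
  proof -
    let ?A = "grid_box n (fst t) (snd t)"
    have A: "?A \<in> sets borel" by (simp add: grid_box_def)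
    have sub: "?A \<subseteq> unit_cube" and vol: "4 * real m \<le> real n * (b * measure lborel ?A)"
      using t by (auto simp: FG_def)
    show "G t \<in> events"
      unfolding G_def by (rule count_lower_tail(1)[OF indepX A prob_ge[OF _ A sub] vol])
    have "emeasure M (G t) \<le> ennreal (exp (- real m / 4))"
      unfolding G_def by (rule count_lower_tail(2)[OF indepX A prob_ge[OF _ A sub] vol])
    then show "prob (G t) \<le> exp (- real m / 4)" by (simp add: emeasure_eq_measure)
  qed
  have ev3: "(\<Union>t\<in>FG. G t) \<in> events" using FG(1) G(1) by auto
  have B3: "prob (\<Union>t\<in>FG. G t) \<le> \<delta>"
  proof -
    have K2: "0 < (2 * real n + 1) ^ (2 * ?d)" by (intro zero_less_power) simp
    \<comment> \<open>The lower bound on \<open>m\<close> beats the number of boxes: the total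
      failure probability is at most \<open>\<delta> / 4\<close>, within the budget
      \<open>\<delta>\<close>.\<close>
    have "exp (- real m / 4) \<le> exp (- ln (4 * (2 * real n + 1) ^ (2 * ?d) / \<delta>))"
      using assms(7) by simp
    also have "\<dots> = \<delta> / (4 * (2 * real n + 1) ^ (2 * ?d))"
      using K2 \<delta> by (simp add: exp_minus)
    finally have "(2 * real n + 1) ^ (2 * ?d) * exp (- real m / 4)
        \<le> (2 * real n + 1) ^ (2 * ?d) * (\<delta> / (4 * (2 * real n + 1) ^ (2 * ?d)))"
      using K2 by (intro mult_left_mono) auto
    also have "\<dots> = \<delta> / 4" using K2 by simp
    also have "\<dots> \<le> \<delta>" using \<delta> by simp
    finally show ?thesis
      using prob_union_bound[OF FG, of "exp (- real m / 4)" G] G by force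
  qed

  \<comment> \<open>Almost sure properties of the sample\<close>
  \<comment> \<open>Any fixed coordinate works: distinct values in one of them are enough for the
    cut argument.\<close>
  define k :: 'd where "k = undefined"
  have AE_cube: "AE w in M. \<forall>i\<in>{1..n}. X i w \<in> unit_cube"
  proof (rule AE_finite_allI)
    fix i assume i: "i \<in> {1..n}"
    have "emeasure M (X i -` (- unit_cube) \<inter> space M) = emeasure M (X 0 -` (- unit_cube) \<inter> space M)"
      by (rule law[OF i]) (simp add: borel_open)
    also have "\<dots> = (\<integral>\<^sup>+x. indicator unit_cube x * ennreal (f\<^sub>X x) * indicator (- unit_cube) x \<partial>lborel)"
      by (rule distributed_emeasure[OF dens]) (simp add: borel_open)
    also have "\<dots> = (\<integral>\<^sup>+x. 0 \<partial>(lborel :: (real ^ 'd) measure))"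
      by (intro nn_integral_cong) (auto simp: indicator_def)
    finally have "emeasure M (X i -` (- unit_cube) \<inter> space M) = 0" by simp
    moreover have "X i -` (- unit_cube) \<inter> space M \<in> events"
      using i by (intro measurable_sets[OF X_meas]) (auto simp: borel_open)
    ultimately show "AE w in M. X i w \<in> unit_cube"
      by (intro AE_I[where N = "X i -` (- unit_cube) \<inter> space M"]) auto
  qed simp
  have ties: "AE w in M. X i w $ k \<noteq> X j w $ k" if ij: "i \<in> {1..n}" "j \<in> {1..n}" "i \<noteq> j" for i j
  proof (rule AE_neq_of_indep)
    \<comment> \<open>The form \<open>insert i {j}\<close> fits the independence of a variable from
      a sum; here the sum over \<open>{j}\<close> is the variable \<open>j\<close> itself.\<close>
    have "indep_vars (\<lambda>_. borel) (\<lambda>i w. X i w $ k) (insert i {j})"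
      by (rule indep_vars_compose2[OF indep_vars_subset[OF indepX]]) (use ij in auto)
    from indep_vars_sum[OF _ _ this] show "indep_var borel (\<lambda>w. X i w $ k) borel (\<lambda>w. X j w $ k)"
      using ij by simp
    fix c
    let ?H = "{x :: real ^ 'd. x $ k = c}"
    have H: "?H \<in> sets borel" by measurable
    have "emeasure M ((\<lambda>w. X j w $ k) -` {c} \<inter> space M) = emeasure M (X j -` ?H \<inter> space M)"
      by (intro arg_cong[where f = "emeasure M"]) auto
    also have "\<dots> = emeasure M (X 0 -` ?H \<inter> space M)" by (rule law[OF ij(2) H])
    also have "\<dots> = (\<integral>\<^sup>+x. indicator unit_cube x * ennreal (f\<^sub>X x) * indicator ?H x \<partial>lborel)"
      by (rule distributed_emeasure[OF dens]) (use H in simp)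
    also have "\<dots> = 0"
      by (rule nn_integral_null_set) (use H emeasure_lborel_hyperplane[of k c] in \<open>simp add: null_sets_def\<close>)
    finally show "emeasure M ((\<lambda>w. X j w $ k) -` {c} \<inter> space M) = 0" .
  qed
  have AE_inj: "AE w in M. \<forall>i\<in>{1..n}. \<forall>j\<in>{1..n}. i \<noteq> j \<longrightarrow> X i w $ k \<noteq> X j w $ k"
    by (intro AE_finite_allI finite_atLeastAtMost AE_impI) (auto intro: ties)
  from AE_cube AE_inj have "AE w in M. (\<forall>i\<in>{1..n}. X i w \<in> unit_cube) \<and> inj_on (\<lambda>i. X i w $ k) {1..n}"
    by eventually_elim (auto simp: inj_on_def)
  then obtain N where N: "{w \<in> space M. \<not> ((\<forall>i\<in>{1..n}. X i w \<in> unit_cube) \<and> inj_on (\<lambda>i. X i w $ k) {1..n})} \<subseteq> N"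
    "emeasure M N = 0" "N \<in> events"
    by (rule AE_E)

  \<comment> \<open>The exceptional event and the conclusion\<close>
  define B where "B = B12 \<union> (\<Union>t\<in>FG. G t) \<union> N"
  have B: "B \<in> events" using B12 ev3 N by (auto simp: B_def)
  have "prob B \<le> prob (B12 \<union> (\<Union>t\<in>FG. G t)) + prob N"
    unfolding B_def using B12 ev3 N by (intro measure_Un_le) auto
  also have "\<dots> \<le> prob B12 + prob (\<Union>t\<in>FG. G t) + prob N"
    using B12 ev3 by (intro add_right_mono measure_Un_le) auto
  \<comment> \<open>\<open>2 * \<delta>\<close> comes from the noise, \<open>\<delta>\<close> from
    the grid counts, and nothing from the null set \<open>N\<close>.\<close>
  also have "\<dots> \<le> 3 * \<delta>" using B12 B3 N(2) by (simp add: measure_def)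
  finally have "1 - 3 * \<delta> \<le> prob (space M - B)" using B by (simp add: prob_compl)
  \<comment> \<open>Outside \<open>B\<close> the bounds hold for all grid boxes in \<open>FG\<close>
    and all index pairs at once, so they apply to the partition although it is selected by the same
    data.\<close>
  moreover have "\<bar>local_estimator n (\<lambda>i. X i w) (\<lambda>i. Y i w) P x - g x\<bar>
      \<le> s + lip_const g (cell_of P x) * \<beta> * sqrt (real ?d) * (5 * real m / (real n * b)) powr (1 / real ?d)"
    if w: "w \<in> space M - B" and x: "x \<in> unit_cube"
      and P: "cart_partition cl n (\<lambda>i. X i w) \<beta> m (cost (\<lambda>i\<in>{1..n}. (X i w, Y i w))) P" for w P x
  proof (rule local_estimator_error[OF P _ m(2) \<beta> x dm _ lip b b1])
    show "\<forall>i\<in>{1..n}. X i w \<in> unit_cube" "inj_on (\<lambda>i. X i w $ k) {1..n}"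
      using N(1) w by (auto simp: B_def)
    show "\<forall>p q. (\<forall>k. p k \<le> 2 * n) \<and> (\<forall>k. q k \<le> 2 * n) \<and> grid_box n p q \<subseteq> unit_cube \<and>
      4 * real m \<le> real n * (b * measure lborel (grid_box n p q)) \<longrightarrow>
      2 * m < num_points n (\<lambda>i. X i w) (grid_box n p q)"
    proof (intro allI impI)
      fix p q :: "'d \<Rightarrow> nat"
      assume "(\<forall>k. p k \<le> 2 * n) \<and> (\<forall>k. q k \<le> 2 * n) \<and> grid_box n p q \<subseteq> unit_cube \<and>
        4 * real m \<le> real n * (b * measure lborel (grid_box n p q))"
      then have "(p, q) \<in> FG" by (auto simp: FG_def)
      then have "w \<notin> G (p, q)" using w by (auto simp: B_def)
      then show "2 * m < num_points n (\<lambda>i. X i w) (grid_box n p q)" using w by (auto simp: G_def)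
    qed
    show "\<forall>p q. (\<forall>k. p k \<in> {1..n}) \<and> (\<forall>k. q k \<in> {1..n}) \<and> m \<le> card (spanned n p q (\<lambda>i. X i w)) \<longrightarrow>
      \<bar>\<Sum>i\<in>spanned n p q (\<lambda>i. X i w). Y i w - g (X i w)\<bar> \<le> s * card (spanned n p q (\<lambda>i. X i w))"
    proof (intro allI impI)
      fix p q :: "'d \<Rightarrow> nat"
      assume pq: "(\<forall>k. p k \<in> {1..n}) \<and> (\<forall>k. q k \<in> {1..n}) \<and> m \<le> card (spanned n p q (\<lambda>i. X i w))"
      then have t: "(p, q) \<in> FT" by (auto simp: FT_def)
      then have "w \<notin> B1 (p, q)" "w \<notin> B2 (p, q)" using w by (auto simp: B_def B12_def)
      then have "(\<Sum>i\<in>spanned n p q (\<lambda>i. X i w). e (X i w, Y i w)) \<le> s * card (spanned n p q (\<lambda>i. X i w))"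
        "(\<Sum>i\<in>spanned n p q (\<lambda>i. X i w). - e (X i w, Y i w)) \<le> s * card (spanned n p q (\<lambda>i. X i w))"
        using bspec[OF B1 t] bspec[OF B2 t] pq w by simp_all
      then show "\<bar>\<Sum>i\<in>spanned n p q (\<lambda>i. X i w). Y i w - g (X i w)\<bar> \<le> s * card (spanned n p q (\<lambda>i. X i w))"
        unfolding sum_negf by (simp add: e_def abs_le_iff)
    qed
  qed
  ultimately show ?thesis
    using B unfolding s_def u_def by (intro bexI[of _ "space M - B"]) auto
qed

end
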